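(* Let $H$ be a graph with $k > 0$ isolated vertices and at least one edge. Then any optimal online algorithm with advice for the Delayed $H$-Edge-Deletion Problem needs at least $\mathrm{opt} \cdot \log \|H\|$ bits of advice.
   Context: Graphs are finite, simple and undirected. $\|G\|$ is the number of edges of $G$; $\log$ is base 2. A graph $G$ is $H$-free if $H$ is not isomorphic to an induced subgraph of $G$. Delayed $H$-Edge-Deletion Problem: $H$ is a fixed graph with at least one edge. An instance is a graph $G$ with an ordering $v_1,\dots,v_n$ of its vertices. In step $i$, vertex $v_i$ and its adjacencies to $v_1,\dots,v_{i-1}$ are revealed, and the algorithm (not knowing the future vertices or $n$) must output a set $S_i\subseteq E(G[\{v_1,\dots,v_i\}])$ such that the graph $G[\{v_1,\dots,v_i\}]-S_i$ obtained by deleting the edges in $S_i$ is $H$-free; moreover $S_1\subseteq\dots\subseteq S_n$. The goal is to minimize $|S_n|$. For an instance, $\mathrm{opt}$ is the minimum size of a set $S\subseteq E(G)$ with $G-S$ $H$-free. An online algorithm with advice is deterministic, and additionally may sequentially read bits from an infinite binary tape. It is optimal if for every instance $I$ there is a tape content $\phi_I$ (chosen by an oracle knowing $I$) with which it outputs a solution of size $\mathrm{opt}(I)$ on $I$. "Any optimal online algorithm needs at least $b(\mathrm{opt})$ bits of advice" means: for every optimal online algorithm with advice, every choice of such tape contents $\phi_I$, and every integer $j\ge 1$, there is an instance $I$ with $\mathrm{opt}(I)=j$ on which the algorithm, run with $\phi_I$, reads at least $b(j)$ bits of the tape. *)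

theory Defs
  imports Complex_Main
begin

text \<open>Finite simple undirected graphs: a vertex set together with a set of two-element vertex sets.\<close>

type_synonym 'a graph = "'a set \<times> 'a set set"

abbreviation verts :: "'a graph \<Rightarrow> 'a set" where "verts \<equiv> fst"
abbreviation edges :: "'a graph \<Rightarrow> 'a set set" where "edges \<equiv> snd"

definition simple_graph :: "'a graph \<Rightarrow> bool" where
  "simple_graph G \<longleftrightarrow> finite (verts G) \<and> (\<forall>e\<in>edges G. e \<subseteq> verts G \<and> card e = 2)"

definition isolated_verts :: "'a graph \<Rightarrow> 'a set" where
  "isolated_verts G = {v \<in> verts G. \<forall>e\<in>edges G. v \<notin> e}"

definition induced :: "'a graph \<Rightarrow> 'a set \<Rightarrow> 'a graph" where
  "induced G W = (W, {e \<in> edges G. e \<subseteq> W})"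

definition delete_edges :: "'a graph \<Rightarrow> 'a set set \<Rightarrow> 'a graph" where
  "delete_edges G S = (verts G, edges G - S)"

definition isomorphic :: "'a graph \<Rightarrow> 'b graph \<Rightarrow> bool" where
  "isomorphic G G' \<longleftrightarrow> (\<exists>f. bij_betw f (verts G) (verts G') \<and> (\<lambda>e. f ` e) ` edges G = edges G')"

definition H_free :: "'a graph \<Rightarrow> 'b graph \<Rightarrow> bool" where
  "H_free H G \<longleftrightarrow> \<not> (\<exists>W \<subseteq> verts G. isomorphic H (induced G W))"

definition opt :: "'a graph \<Rightarrow> 'b graph \<Rightarrow> nat" where
  "opt H G = (LEAST m. \<exists>S \<subseteq> edges G. H_free H (delete_edges G S) \<and> card S = m)"

text \<open>An instance is a graph together with an ordering of its vertices; what has been revealed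
  after \<open>i\<close> steps is again an instance.\<close>

type_synonym inst = "nat graph \<times> nat list"

definition is_instance :: "inst \<Rightarrow> bool" where
  "is_instance I \<longleftrightarrow> (case I of (G, vs) \<Rightarrow> simple_graph G \<and> distinct vs \<and> set vs = verts G)"

definition num_steps :: "inst \<Rightarrow> nat" where
  "num_steps I = length (snd I)"

definition revealed :: "inst \<Rightarrow> nat \<Rightarrow> inst" where
  "revealed I i = (case I of (G, vs) \<Rightarrow> (induced G (set (take i vs)), take i vs))"

text \<open>A sequence \<open>S\<close> is indexed from \<open>1\<close> to the number of steps.\<close>

definition is_solution :: "'a graph \<Rightarrow> inst \<Rightarrow> (nat \<Rightarrow> nat set set) \<Rightarrow> bool" where
  "is_solution H I S \<longleftrightarrow>
     (\<forall>i\<in>{1..num_steps I}. S i \<subseteq> edges (fst (revealed I i)) \<and>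
        H_free H (delete_edges (fst (revealed I i)) (S i))) \<and>
     (\<forall>i\<in>{1..<num_steps I}. S i \<subseteq> S (Suc i))"

text \<open>The internal state of a deterministic online algorithm is determined by what has been
  revealed so far and by the list of tape bits it has read so far. In each state it either reads
  the next bit of the tape or ends the current step with an output. Reading forever, i.e. not
  completing a step, is possible for some tapes.\<close>

datatype action = Read | Output "nat set set"

type_synonym algorithm = "inst \<Rightarrow> bool list \<Rightarrow> action"
type_synonym tape = "nat \<Rightarrow> bool"

text \<open>\<open>answers A \<phi> P m S m'\<close>: having read \<open>m\<close> bits of \<open>\<phi>\<close> before the step in which the
  revealed part becomes \<open>P\<close>, the algorithm outputs \<open>S\<close> in this step and has then read \<open>m'\<close> bits.\<close>

inductive answers :: "algorithm \<Rightarrow> tape \<Rightarrow> inst \<Rightarrow> nat \<Rightarrow> nat set set \<Rightarrow> nat \<Rightarrow> bool"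
  for A :: algorithm and \<phi> :: tape and P :: inst where
  answers_output: "A P (map \<phi> [0..<m]) = Output S \<Longrightarrow> answers A \<phi> P m S m"
| answers_read: "A P (map \<phi> [0..<m]) = Read \<Longrightarrow> answers A \<phi> P (Suc m) S m' \<Longrightarrow> answers A \<phi> P m S m'"

text \<open>\<open>S i\<close> is the output of step \<open>i\<close> and \<open>b i\<close> the number of bits read up to the end of
  step \<open>i\<close>; index \<open>0\<close> describes the situation before the first step.\<close>

definition is_run ::
  "algorithm \<Rightarrow> tape \<Rightarrow> inst \<Rightarrow> (nat \<Rightarrow> nat set set) \<Rightarrow> (nat \<Rightarrow> nat) \<Rightarrow> bool" where
  "is_run A \<phi> I S b \<longleftrightarrow> S 0 = {} \<and> b 0 = 0 \<and>
     (\<forall>i<num_steps I. answers A \<phi> (revealed I (Suc i)) (b i) (S (Suc i)) (b (Suc i)))"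

lemma answers_unique:
  "answers A \<phi> P m S c \<Longrightarrow> answers A \<phi> P m S' c' \<Longrightarrow> S' = S \<and> c' = c"
proof (induction rule: answers.induct)
  case (answers_output m S)
  from answers_output(2) show ?case by cases (use answers_output(1) in auto)
next
  case (answers_read m S m')
  from answers_read(4) show ?case by cases (use answers_read(1,3) in auto)
qed

lemma is_run_unique:
  assumes "is_run A \<phi> I S b" "is_run A \<phi> I S' b'" "i \<le> num_steps I"
  shows "S' i = S i \<and> b' i = b i"
  using assms(3)
proof (induction i)
  case 0
  then show ?case using assms(1,2) by (simp add: is_run_def)
next
  case (Suc i)
  then have "b' i = b i" "i < num_steps I" by auto
  then show ?case using assms(1,2) answers_unique unfolding is_run_def by metis
qed

definition reads_bits :: "algorithm \<Rightarrow> tape \<Rightarrow> inst \<Rightarrow> nat \<Rightarrow> bool" where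
  "reads_bits A \<phi> I c \<longleftrightarrow> (\<exists>S b. is_run A \<phi> I S b \<and> b (num_steps I) = c)"

definition optimal_on :: "'a graph \<Rightarrow> algorithm \<Rightarrow> tape \<Rightarrow> inst \<Rightarrow> bool" where
  "optimal_on H A \<phi> I \<longleftrightarrow> (\<exists>S b. is_run A \<phi> I S b \<and> is_solution H I S \<and>
     card (S (num_steps I)) = opt H (fst I))"

definition optimal :: "'a graph \<Rightarrow> algorithm \<Rightarrow> bool" where
  "optimal H A \<longleftrightarrow> (\<forall>I. is_instance I \<longrightarrow> (\<exists>\<phi>. optimal_on H A \<phi> I))"

definition needs_advice :: "'a graph \<Rightarrow> (nat \<Rightarrow> real) \<Rightarrow> bool" where
  "needs_advice H f \<longleftrightarrow>
     (\<forall>A \<Phi>. optimal H A \<and> (\<forall>I. is_instance I \<longrightarrow> optimal_on H A (\<Phi> I) I) \<longrightarrow>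
        (\<forall>j\<ge>1. \<exists>I c. is_instance I \<and> opt H (fst I) = j \<and> reads_bits A (\<Phi> I) I c \<and> f j \<le> real c))"

end

theory Submission
  imports Defs "HOL-Library.FuncSet"
begin

text \<open>
  For every edge \<open>e\<close> of \<open>H\<close> there is a graph \<open>G\<^sub>e\<close> containing an induced copy of \<open>H\<close> in which \<open>e\<close> is the
  only edge of that copy whose deletion makes \<open>G\<^sub>e\<close> \<open>H\<close>-free. Reveal first \<open>j\<close> copies of \<open>H\<close> with all edges
  between different copies, and then extend the \<open>i\<close>-th copy to \<open>G\<^sub>e\<close> with \<open>e = e\<^sub>i\<close>, again with all edges
  between different blocks. As \<open>H\<close> has an isolated vertex, every induced copy of \<open>H\<close> lies within one
  block. So the optimum is \<open>j\<close>, the deletions are forced already by the common prefix, and they have to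
  be exactly \<open>e\<^sub>1, \<dots>, e\<^sub>j\<close>. The outputs on the common prefix therefore separate all choices of
  the \<open>e\<^sub>i\<close>, and they depend only on the tape bits read so far.

  To construct \<open>G\<^sub>e\<close>, let \<open>V'\<close> be the set of nonisolated vertices of \<open>H\<close>, and \<open>X \<subseteq> V'\<close> a smallest nonempty
  set completely joined to \<open>V' - X\<close>. If \<open>X\<close> contains nonadjacent vertices \<open>y\<close>, \<open>z\<close>, then on every edge
  \<open>e' \<noteq> e\<close> glue a copy of \<open>H + yz\<close> along \<open>yz\<close>, and join its new vertices to everything else.
  Otherwise a vertex of \<open>H\<close> is adjacent to all of \<open>V'\<close>, and one glues a second copy of \<open>H\<close> along \<open>e\<close> with
  the ends of \<open>e\<close> swapped.
\<close>

section \<open>Induced embeddings\<close>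

text \<open>Copies of \<open>H\<close> are recorded as maps instead of vertex sets, so that they can
  be composed and restricted. For \<open>x = y\<close> both sides of the equivalence are false in
  simple graphs.\<close>

definition embeds :: "('a \<Rightarrow> 'b) \<Rightarrow> 'a graph \<Rightarrow> 'b graph \<Rightarrow> bool" where
  "embeds f H G \<longleftrightarrow> inj_on f (verts H) \<and> f ` verts H \<subseteq> verts G \<and>
     (\<forall>x\<in>verts H. \<forall>y\<in>verts H. {x, y} \<in> edges H \<longleftrightarrow> {f x, f y} \<in> edges G)"

lemma simple_graphE:
  assumes "simple_graph G" "e \<in> edges G"
  obtains x y where "e = {x, y}" "x \<noteq> y" "x \<in> verts G" "y \<in> verts G"
proof -
  have "e \<subseteq> verts G" "card e = 2" using assms unfolding simple_graph_def by auto
  then obtain x y where "e = {x, y}" "x \<noteq> y" unfolding card_2_iff by blast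
  with \<open>e \<subseteq> verts G\<close> that show ?thesis by blast
qed

lemma simple_graph_edgeD:
  assumes "simple_graph G" "{x, y} \<in> edges G"
  shows "x \<noteq> y" "x \<in> verts G" "y \<in> verts G"
proof -
  have "{x, y} \<subseteq> verts G" "card {x, y} = 2" using assms unfolding simple_graph_def by auto
  then show "x \<noteq> y" "x \<in> verts G" "y \<in> verts G" by auto
qed

lemma simple_graph_edgeE:
  assumes "simple_graph G" "e \<in> edges G" "x \<in> e"
  obtains y where "e = {x, y}" "x \<noteq> y" "x \<in> verts G" "y \<in> verts G"
proof -
  obtain a b where ab: "e = {a, b}" "a \<noteq> b" "a \<in> verts G" "b \<in> verts G"
    using simple_graphE[OF assms(1,2)] .
  show ?thesis
  proof (cases "x = a")
    case True
    then show ?thesis using that[of b] ab by simp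
  next
    case False
    then show ?thesis using that[of a] ab assms(3) by auto
  qed
qed

lemma simple_graph_finite_edges: "simple_graph G \<Longrightarrow> finite (edges G)"
  unfolding simple_graph_def by (rule finite_subset[of _ "Pow (verts G)"]) auto

lemma simple_graph_delete_edges: "simple_graph G \<Longrightarrow> simple_graph (delete_edges G S)"
  unfolding simple_graph_def delete_edges_def by auto

lemma edge_delete_edges:
  "s \<in> edges (delete_edges G S) \<longleftrightarrow> s \<in> edges G \<and> s \<notin> S"
  by (simp add: delete_edges_def)

lemma isolated_verts_edgeD: "{x, y} \<in> edges G \<Longrightarrow> x \<notin> isolated_verts G \<and> y \<notin> isolated_verts G"
  unfolding isolated_verts_def by auto

lemma embeds_image_edges:
  assumes "simple_graph H" "simple_graph G" "embeds f H G"
  shows "(\<lambda>e. f ` e) ` edges H = {s \<in> edges G. s \<subseteq> f ` verts H}"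
proof (intro set_eqI iffI)
  fix s assume "s \<in> (\<lambda>e. f ` e) ` edges H"
  then obtain e where e: "e \<in> edges H" "s = f ` e" by auto
  obtain x y where "e = {x, y}" "x \<in> verts H" "y \<in> verts H"
    using simple_graphE[OF assms(1) e(1)] by metis
  then show "s \<in> {s \<in> edges G. s \<subseteq> f ` verts H}"
    using e assms(3) unfolding embeds_def by auto
next
  fix s assume "s \<in> {s \<in> edges G. s \<subseteq> f ` verts H}"
  then have s: "s \<in> edges G" "s \<subseteq> f ` verts H" by auto
  obtain x y where xy: "s = {x, y}" using simple_graphE[OF assms(2) s(1)] by metis
  then obtain a b where ab: "x = f a" "y = f b" "a \<in> verts H" "b \<in> verts H" using s(2) by auto
  then have "{a, b} \<in> edges H" using assms(3) s(1) xy unfolding embeds_def by auto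
  moreover have "s = f ` {a, b}" using xy ab by auto
  ultimately show "s \<in> (\<lambda>e. f ` e) ` edges H" by blast
qed

lemma inj_on_image_edges:
  assumes "simple_graph H" "inj_on f (verts H)"
  shows "inj_on (\<lambda>e. f ` e) (edges H)"
proof (rule inj_onI)
  fix s t assume "s \<in> edges H" "t \<in> edges H" "f ` s = f ` t"
  moreover have "s \<subseteq> verts H" "t \<subseteq> verts H"
    using assms(1) \<open>s \<in> edges H\<close> \<open>t \<in> edges H\<close> unfolding simple_graph_def by auto
  ultimately show "s = t" using inj_on_image_eq_iff[OF assms(2)] by blast
qed

text \<open>Serves as an obstruction: a vertex set that spans the wrong number of edges carries no
  copy of \<open>H\<close>.\<close>

lemma embeds_card_edges:
  assumes "simple_graph H" "simple_graph G" "embeds f H G"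
  shows "card {s \<in> edges G. s \<subseteq> f ` verts H} = card (edges H)"
proof -
  have "inj_on f (verts H)" using assms(3) unfolding embeds_def by auto
  from card_image[OF inj_on_image_edges[OF assms(1) this]]
  show ?thesis unfolding embeds_image_edges[OF assms] .
qed

lemma H_free_iff_no_embedding:
  assumes "simple_graph H" "simple_graph G"
  shows "H_free H G \<longleftrightarrow> \<not> (\<exists>f. embeds f H G)"
proof -
  have "(\<exists>W \<subseteq> verts G. isomorphic H (induced G W)) \<longleftrightarrow> (\<exists>f. embeds f H G)"
  proof
    assume "\<exists>W \<subseteq> verts G. isomorphic H (induced G W)"
    then obtain W f where W: "W \<subseteq> verts G" and f: "bij_betw f (verts H) W"
      and E: "(\<lambda>e. f ` e) ` edges H = {e \<in> edges G. e \<subseteq> W}"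
      unfolding isomorphic_def induced_def by auto
    have inj: "inj_on f (verts H)" and img: "f ` verts H = W" using f unfolding bij_betw_def by auto
    have "embeds f H G" unfolding embeds_def
    proof (intro conjI ballI)
      show "inj_on f (verts H)" by fact
      show "f ` verts H \<subseteq> verts G" using img W by simp
      fix x y assume xy: "x \<in> verts H" "y \<in> verts H"
      show "{x, y} \<in> edges H \<longleftrightarrow> {f x, f y} \<in> edges G"
      proof
        assume "{x, y} \<in> edges H"
        then have "f ` {x, y} \<in> (\<lambda>e. f ` e) ` edges H" by blast
        then show "{f x, f y} \<in> edges G" unfolding E by simp
      next
        assume "{f x, f y} \<in> edges G"
        then have "f ` {x, y} \<in> (\<lambda>e. f ` e) ` edges H" unfolding E using xy img by auto
        then obtain e where e: "e \<in> edges H" "f ` {x, y} = f ` e" by blast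
        have "e \<subseteq> verts H" using e assms(1) unfolding simple_graph_def by auto
        then have "e = {x, y}" using e(2) inj_on_image_eq_iff[OF inj, of "{x, y}" e] xy by auto
        then show "{x, y} \<in> edges H" using e by simp
      qed
    qed
    then show "\<exists>f. embeds f H G" by blast
  next
    assume "\<exists>f. embeds f H G"
    then obtain f where f: "embeds f H G" by blast
    have "isomorphic H (induced G (f ` verts H))"
      unfolding isomorphic_def induced_def
      using f embeds_image_edges[OF assms f]
      by (intro exI[of _ f]) (auto simp: embeds_def bij_betw_def)
    moreover have "f ` verts H \<subseteq> verts G" using f unfolding embeds_def by auto
    ultimately show "\<exists>W \<subseteq> verts G. isomorphic H (induced G W)" by blast
  qed
  then show ?thesis unfolding H_free_def by simp
qed

lemma embeds_not_H_free:
  assumes "simple_graph H" "simple_graph G" "embeds f H G"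
  shows "\<not> H_free H G"
  unfolding H_free_iff_no_embedding[OF assms(1,2)] not_not by (rule exI) (rule assms(3))

text \<open>Deletions keep nonadjacent pairs nonadjacent, so a copy that loses no edge survives as
  an induced copy under the same map.\<close>

lemma embeds_hits_deleted:
  assumes "simple_graph H" "simple_graph G" "embeds f H G" "H_free H (delete_edges G S)"
  shows "\<exists>e\<in>edges H. f ` e \<in> S"
proof (rule ccontr)
  assume *: "\<not> ?thesis"
  have "embeds f H (delete_edges G S)" unfolding embeds_def
  proof (intro conjI ballI)
    show "inj_on f (verts H)" "f ` verts H \<subseteq> verts (delete_edges G S)"
      using assms(3) unfolding embeds_def delete_edges_def by auto
    fix x y assume "x \<in> verts H" "y \<in> verts H"
    then have "{x, y} \<in> edges H \<longleftrightarrow> {f x, f y} \<in> edges G" using assms(3) unfolding embeds_def by auto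
    moreover have "{f x, f y} \<notin> S" if "{x, y} \<in> edges H" using * that by fastforce
    ultimately show "{x, y} \<in> edges H \<longleftrightarrow> {f x, f y} \<in> edges (delete_edges G S)"
      unfolding delete_edges_def by auto
  qed
  then show False
    using assms(4) H_free_iff_no_embedding[OF assms(1) simple_graph_delete_edges[OF assms(2)]] by blast
qed

text \<open>Two copies of \<open>H\<close> have equally many vertices, so inclusion would make their
  vertex sets equal; but on that set the deletion of \<open>s\<close> leaves one edge fewer than
  \<open>H\<close> has.\<close>

lemma embeds_delete_edge_not_subset:
  assumes "simple_graph H" "simple_graph G" "embeds g H G" "s \<in> (\<lambda>e. g ` e) ` edges H"
    and f: "embeds f H (delete_edges G {s})"
  shows "\<not> f ` verts H \<subseteq> g ` verts H"
proof
  assume sub: "f ` verts H \<subseteq> g ` verts H"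
  have fin: "finite (verts H)" "finite (edges H)"
    using assms(1) simple_graph_finite_edges[OF assms(1)] unfolding simple_graph_def by auto
  have "inj_on f (verts H)" "inj_on g (verts H)" using assms(3) f unfolding embeds_def by simp_all
  then have "card (f ` verts H) = card (g ` verts H)" by (simp add: card_image)
  then have eq: "f ` verts H = g ` verts H" using sub fin(1) by (intro card_subset_eq) auto
  have "{t \<in> edges (delete_edges G {s}). t \<subseteq> f ` verts H} = (\<lambda>e. g ` e) ` edges H - {s}"
    unfolding eq edge_delete_edges embeds_image_edges[OF assms(1-3)] by blast
  then have "card ((\<lambda>e. g ` e) ` edges H - {s}) = card (edges H)"
    using embeds_card_edges[OF assms(1) simple_graph_delete_edges[OF assms(2)] f] by simp
  moreover have "card ((\<lambda>e. g ` e) ` edges H - {s}) < card ((\<lambda>e. g ` e) ` edges H)"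
    using finite_imageI[OF fin(2)] assms(4) by (rule card_Diff1_less)
  moreover have "\<dots> \<le> card (edges H)" by (rule card_image_le[OF fin(2)])
  ultimately show False by simp
qed

definition graph_on :: "'a set \<Rightarrow> ('a \<Rightarrow> 'a \<Rightarrow> bool) \<Rightarrow> 'a graph" where
  "graph_on V adj = (V, {{x, y} | x y. x \<in> V \<and> y \<in> V \<and> x \<noteq> y \<and> adj x y})"

lemma verts_graph_on [simp]: "verts (graph_on V adj) = V"
  by (simp add: graph_on_def)

lemma edge_graph_on:
  assumes "symp adj"
  shows "{x, y} \<in> edges (graph_on V adj) \<longleftrightarrow> x \<in> V \<and> y \<in> V \<and> x \<noteq> y \<and> adj x y"
  using sympD[OF assms] unfolding graph_on_def by (auto simp: doubleton_eq_iff)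

lemma simple_graph_on: "finite V \<Longrightarrow> simple_graph (graph_on V adj)"
  unfolding simple_graph_def graph_on_def by auto

section \<open>Extensions in which one edge is critical\<close>

text \<open>Vertices \<open>(v, {})\<close> form the given copy of \<open>H\<close>; \<open>(v, e')\<close> are new vertices of a copy glued on \<open>e'\<close>.\<close>

definition critical_extension :: "'a graph \<Rightarrow> 'a set \<Rightarrow> ('a \<times> 'a set) graph \<Rightarrow> bool" where
  "critical_extension H e G \<longleftrightarrow> simple_graph G \<and> verts G \<subseteq> verts H \<times> insert {} (edges H) \<and>
     embeds (\<lambda>x. (x, {})) H G \<and>
     H_free H (delete_edges G {(\<lambda>x. (x, {})) ` e}) \<and>
     (\<forall>e'\<in>edges H - {e}. \<not> H_free H (delete_edges G {(\<lambda>x. (x, {})) ` e'}))"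

text \<open>In a copy of \<open>H\<close> that meets the new vertices glued on \<open>e'\<close> and leaves that glued copy, an isolated
  vertex can only be an end of \<open>e'\<close>. It is nonadjacent to the new vertices used, which are completely joined
  to all other nonisolated vertices, but there are fewer than \<open>card X\<close> of them.\<close>

lemma critical_extension_nonadjacent_pair:
  assumes H: "simple_graph H" and iso: "isolated_verts H \<noteq> {}"
    and X: "X \<subseteq> verts H - isolated_verts H"
    and joined: "\<And>p q. p \<in> X \<Longrightarrow> q \<in> verts H - isolated_verts H - X \<Longrightarrow> {p, q} \<in> edges H"
    and min: "\<And>Y. Y \<noteq> {} \<Longrightarrow> Y \<subseteq> verts H - isolated_verts H \<Longrightarrow>
      (\<And>p q. p \<in> Y \<Longrightarrow> q \<in> verts H - isolated_verts H - Y \<Longrightarrow> {p, q} \<in> edges H) \<Longrightarrow> card X \<le> card Y"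
    and yz: "y \<in> X" "z \<in> X" "y \<noteq> z" "{y, z} \<notin> edges H"
    and e: "e \<in> edges H"
  shows "\<exists>G. critical_extension H e G"
proof -
  let ?E = "edges H"
  let ?V = "verts H"
  let ?\<iota> = "\<lambda>x::'a. (x, {}::'a set)"
  have finV: "finite ?V" using H unfolding simple_graph_def by simp
  have finE: "finite ?E" by (rule simple_graph_finite_edges[OF H])
  have yzV: "y \<in> ?V" "z \<in> ?V" using X yz by auto
  have empE: "{} \<notin> ?E" using H unfolding simple_graph_def by auto
  have E2: "x \<noteq> x'" "x \<in> ?V" "x' \<in> ?V" if "{x, x'} \<in> ?E" for x x'
    using simple_graph_edgeD[OF H that] .
  \<comment> \<open>An arbitrary choice orients each \<open>e'\<close>: the end
    \<open>\<alpha> e'\<close> takes the place of \<open>y\<close> in the glued copy, the other end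
    that of \<open>z\<close>.\<close>
  define \<alpha> where "\<alpha> e' = (SOME a. a \<in> e')" for e' :: "'a set"
  have \<alpha>: "\<alpha> e' \<in> e'" if "e' \<in> ?E" for e'
    using that empE unfolding \<alpha>_def by (metis some_in_eq)
  define role where "role e' x = (if x = \<alpha> e' then y else z)" for e' x
  \<comment> \<open>Level \<open>e'\<close> lacks \<open>y\<close> and \<open>z\<close>, which are
    identified with the ends of \<open>e'\<close>. Nothing is glued on \<open>e\<close>.\<close>
  define VG where "VG = ?V \<times> {{}} \<union> (?V - {y, z}) \<times> (?E - {e})"
  \<comment> \<open>The inner implications are vacuous unless the old vertex is an end of
    \<open>e'\<close>: all other old vertices are joined to the new ones, and different new levels
    are joined to each other.\<close>
  define adj where "adj p q \<longleftrightarrow>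
    (if snd p = snd q then {fst p, fst q} \<in> ?E
     else if snd p = {} then fst p \<in> snd q \<longrightarrow> {role (snd q) (fst p), fst q} \<in> ?E
     else if snd q = {} then fst q \<in> snd p \<longrightarrow> {role (snd p) (fst q), fst p} \<in> ?E
     else True)" for p q :: "'a \<times> 'a set"
  have "symp adj" by (rule sympI) (auto simp: adj_def insert_commute split: if_splits)
  define G where "G = graph_on VG adj"
  have VG: "verts G = VG" unfolding G_def by simp
  have edge: "{p, q} \<in> edges G \<longleftrightarrow> p \<in> VG \<and> q \<in> VG \<and> p \<noteq> q \<and> adj p q" for p q
    unfolding G_def by (rule edge_graph_on[OF \<open>symp adj\<close>])
  have "finite VG" unfolding VG_def using finV finE by auto
  then have G: "simple_graph G" unfolding G_def by (rule simple_graph_on)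
  have base: "embeds ?\<iota> H G"
    unfolding embeds_def edge VG by (auto simp: inj_on_def VG_def adj_def dest: E2)
  \<comment> \<open>The glued copy is \<open>H\<close> with the additional edge \<open>yz\<close>,
    placed on \<open>e'\<close>. As \<open>y\<close> and \<open>z\<close> are nonadjacent in
    \<open>H\<close>, deleting \<open>e'\<close> leaves exactly \<open>H\<close> there.\<close>
  have copy: "\<exists>\<kappa>. embeds \<kappa> H (delete_edges G {?\<iota> ` e'}) \<and>
      \<kappa> ` ?V = (?V - {y, z}) \<times> {e'} \<union> ?\<iota> ` e'" if e': "e' \<in> ?E - {e}" for e'
  proof -
    have e'E: "e' \<in> ?E" using e' by simp
    obtain \<beta> where \<beta>: "e' = {\<alpha> e', \<beta>}" "\<alpha> e' \<noteq> \<beta>" "\<alpha> e' \<in> ?V" "\<beta> \<in> ?V"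
      using simple_graph_edgeE[OF H e'E \<alpha>[OF e'E]] .
    have ne: "e' \<noteq> {}" using empE e' by blast
    define \<kappa> where "\<kappa> x = (if x = y then (\<alpha> e', {}) else if x = z then (\<beta>, {}) else (x, e'))" for x
    have mem: "\<beta> \<in> e'" "\<alpha> e' \<in> e'" using \<beta>(1) by blast+
    have im: "?\<iota> ` e' = {(\<alpha> e', {}), (\<beta>, {})}" using \<beta>(1) by blast
    have inj: "inj_on \<kappa> ?V" using \<beta>(2) ne yz(3) by (auto simp: inj_on_def \<kappa>_def)
    have img: "\<kappa> ` ?V = (?V - {y, z}) \<times> {e'} \<union> ?\<iota> ` e'"
      unfolding im using yz(3) yzV by (auto simp: \<kappa>_def image_iff)
    have VGk: "\<kappa> x \<in> VG" if "x \<in> ?V" for x using that \<beta> e' unfolding VG_def \<kappa>_def by auto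
    have adjk: "{x, x'} \<in> ?E \<longleftrightarrow> adj (\<kappa> x) (\<kappa> x') \<and> {\<kappa> x, \<kappa> x'} \<noteq> ?\<iota> ` e'"
      if "x \<in> ?V" "x' \<in> ?V" "x \<noteq> x'" for x x'
    proof -
      have adj': "adj (\<kappa> x) (\<kappa> x') \<longleftrightarrow> {x, x'} \<in> ?E \<or> {x, x'} = {y, z}"
      proof (cases "x \<in> {y, z}"; cases "x' \<in> {y, z}")
        assume "x \<in> {y, z}" "x' \<in> {y, z}"
        moreover have "{\<alpha> e', \<beta>} \<in> ?E" "{\<beta>, \<alpha> e'} \<in> ?E" using e'E \<beta>(1) by (simp_all add: insert_commute)
        ultimately show ?thesis using that(3) yz(3) by (auto simp: \<kappa>_def adj_def)
      next
        assume "x \<in> {y, z}" "x' \<notin> {y, z}"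
        then show ?thesis using mem ne \<beta>(2) yz(3)
          by (auto simp: \<kappa>_def adj_def role_def doubleton_eq_iff)
      next
        assume "x \<notin> {y, z}" "x' \<in> {y, z}"
        then show ?thesis using mem ne \<beta>(2) yz(3)
          by (auto simp: \<kappa>_def adj_def role_def doubleton_eq_iff insert_commute)
      next
        assume "x \<notin> {y, z}" "x' \<notin> {y, z}"
        then show ?thesis by (auto simp: \<kappa>_def adj_def doubleton_eq_iff)
      qed
      have "{\<kappa> x, \<kappa> x'} = ?\<iota> ` e' \<longleftrightarrow> {x, x'} = {y, z}"
        unfolding im using ne \<beta>(2) yz(3) by (simp add: \<kappa>_def doubleton_eq_iff)
      then show ?thesis using adj' yz(4) by (cases "{x, x'} = {y, z}") simp_all
    qed
    have "embeds \<kappa> H (delete_edges G {?\<iota> ` e'})"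
      unfolding embeds_def edge_delete_edges edge
    proof (intro conjI ballI)
      show "inj_on \<kappa> ?V" by (rule inj)
      show "\<kappa> ` ?V \<subseteq> verts (delete_edges G {?\<iota> ` e'})" using VGk VG by (auto simp: delete_edges_def)
      fix x x' assume x: "x \<in> ?V" "x' \<in> ?V"
      show "{x, x'} \<in> ?E \<longleftrightarrow> (\<kappa> x \<in> VG \<and> \<kappa> x' \<in> VG \<and> \<kappa> x \<noteq> \<kappa> x' \<and> adj (\<kappa> x) (\<kappa> x')) \<and>
        {\<kappa> x, \<kappa> x'} \<notin> {?\<iota> ` e'}"
      proof (cases "x = x'")
        case True
        then show ?thesis using E2[of x x'] by auto
      next
        case False
        then have "\<kappa> x \<noteq> \<kappa> x'" using inj x by (auto dest: inj_onD)
        then show ?thesis using adjk[OF x False] VGk x by auto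
      qed
    qed
    then show ?thesis using img by blast
  qed
  have crit: "\<not> H_free H (delete_edges G {?\<iota> ` e'})" if e': "e' \<in> ?E - {e}" for e'
  proof -
    obtain \<kappa> where "embeds \<kappa> H (delete_edges G {?\<iota> ` e'})" using copy[OF e'] by (elim exE conjE)
    then show ?thesis by (rule embeds_not_H_free[OF H simple_graph_delete_edges[OF G]])
  qed
  have free: "H_free H (delete_edges G {?\<iota> ` e})"
  proof (rule ccontr)
    let ?D = "delete_edges G {?\<iota> ` e}"
    have D: "simple_graph ?D" by (rule simple_graph_delete_edges[OF G])
    assume "\<not> H_free H ?D"
    then obtain f where f: "embeds f H ?D" using H_free_iff_no_embedding[OF H D] by blast
    have injf: "inj_on f ?V" using f unfolding embeds_def by simp
    have fVG: "f x \<in> VG" if "x \<in> ?V" for x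
      using f that VG unfolding embeds_def delete_edges_def by auto
    have fedge: "{x, x'} \<in> ?E \<longleftrightarrow> {f x, f x'} \<in> edges ?D" if "x \<in> ?V" "x' \<in> ?V" for x x'
      using f that unfolding embeds_def by auto
    have fcard: "card {s \<in> edges ?D. s \<subseteq> f ` ?V} = card ?E" by (rule embeds_card_edges[OF H D f])
    have cardf: "card (f ` ?V) = card ?V" by (rule card_image[OF injf])
    \<comment> \<open>The deleted edge lies on level \<open>{}\<close>, so pairs with a new vertex
      are unaffected.\<close>
    have D_cross: "{p, q} \<in> edges ?D" if "p \<in> VG" "q \<in> VG" "snd p \<noteq> {}" "snd q \<noteq> snd p"
      "snd q = {} \<Longrightarrow> fst q \<notin> snd p" for p q
    proof -
      have "adj p q" using that unfolding adj_def by auto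
      moreover have "p \<notin> ?\<iota> ` e" using that(3) by auto
      then have "{p, q} \<noteq> ?\<iota> ` e" by blast
      ultimately show ?thesis using that edge unfolding edge_delete_edges by auto
    qed
    show False
    proof (cases "f ` ?V \<subseteq> ?\<iota> ` ?V")
      case True
      moreover have "?\<iota> ` e \<in> (\<lambda>s. ?\<iota> ` s) ` ?E" using e by (rule imageI)
      ultimately show False using embeds_delete_edge_not_subset[OF H G base _ f] by blast
    next
      case False
      then obtain x0 where x0: "x0 \<in> ?V" "f x0 \<notin> ?\<iota> ` ?V" by blast
      define e' where "e' = snd (f x0)"
      have e': "e' \<in> ?E - {e}" "fst (f x0) \<in> ?V - {y, z}"
        using fVG[OF x0(1)] x0(2) unfolding e'_def VG_def by auto
      have e'ne: "e' \<noteq> {}" using e' empE by blast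
      have e'E: "e' \<in> ?E" using e'(1) by simp
      obtain \<kappa> where \<kappa>: "embeds \<kappa> H (delete_edges G {?\<iota> ` e'})"
        and \<kappa>V: "\<kappa> ` ?V = (?V - {y, z}) \<times> {e'} \<union> ?\<iota> ` e'" using copy[OF e'(1)] by blast
      have e'D: "?\<iota> ` e' \<in> edges ?D"
      proof -
        have "?\<iota> ` e' \<in> (\<lambda>s. ?\<iota> ` s) ` ?E" using e'E by blast
        then have "?\<iota> ` e' \<in> edges G" unfolding embeds_image_edges[OF H G base] by simp
        moreover have "?\<iota> ` e' \<noteq> ?\<iota> ` e" using e'(1) inj_image_eq_iff[of ?\<iota> e' e] by (auto simp: inj_def)
        ultimately show ?thesis by (simp add: edge_delete_edges)
      qed
      show False
      proof (cases "f ` ?V \<subseteq> \<kappa> ` ?V")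
        case True
        have "inj_on \<kappa> ?V" using \<kappa> unfolding embeds_def by simp
        from card_image[OF this] have eq: "f ` ?V = \<kappa> ` ?V"
          using True finV cardf by (intro card_subset_eq) auto
        \<comment> \<open>The image of \<open>\<kappa>\<close> meets level \<open>{}\<close> only in
          the ends of \<open>e'\<close>, so it does not contain both ends of \<open>e\<close>. The
          deletion of \<open>e\<close> is not felt there, and the set spans
          \<open>card ?E + 1\<close> edges, one too many for a copy of \<open>H\<close>.\<close>
        have "\<not> e \<subseteq> e'"
        proof
          assume "e \<subseteq> e'"
          moreover have "card e = 2" "card e' = 2" using H e e'(1) unfolding simple_graph_def by auto
          ultimately have "e = e'" by (metis card_subset_eq card.infinite zero_neq_numeral)
          then show False using e'(1) by simp
        qed
        then have "\<not> ?\<iota> ` e \<subseteq> \<kappa> ` ?V" unfolding \<kappa>V using e'ne by auto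
        moreover have "?\<iota> ` e' \<subseteq> \<kappa> ` ?V" unfolding \<kappa>V by blast
        ultimately have "{s \<in> edges ?D. s \<subseteq> f ` ?V} =
            insert (?\<iota> ` e') {s \<in> edges (delete_edges G {?\<iota> ` e'}). s \<subseteq> \<kappa> ` ?V}"
          using e'D unfolding eq edge_delete_edges by blast
        moreover have "?\<iota> ` e' \<notin> {s \<in> edges (delete_edges G {?\<iota> ` e'}). s \<subseteq> \<kappa> ` ?V}"
          by (simp add: edge_delete_edges)
        moreover have "card {s \<in> edges (delete_edges G {?\<iota> ` e'}). s \<subseteq> \<kappa> ` ?V} = card ?E"
          by (rule embeds_card_edges[OF H simple_graph_delete_edges[OF G] \<kappa>])
        moreover have "finite {s \<in> edges (delete_edges G {?\<iota> ` e'}). s \<subseteq> \<kappa> ` ?V}"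
          using simple_graph_finite_edges[OF simple_graph_delete_edges[OF G]] by simp
        ultimately show False using fcard by simp
      next
        case False
        then obtain x1 where x1: "x1 \<in> ?V" "f x1 \<notin> \<kappa> ` ?V" by blast
        let ?inB = "\<lambda>x. snd (f x) = e'"
        let ?out = "\<lambda>x. f x \<notin> \<kappa> ` ?V"
        have inB: "f x \<in> \<kappa> ` ?V" if "x \<in> ?V" "?inB x" for x
          using fVG[OF that(1)] that(2) e'ne unfolding \<kappa>V VG_def by auto
        have cross: "{x, x'} \<in> ?E" if "x \<in> ?V" "x' \<in> ?V" "?inB x" "?out x'" for x x'
        proof -
          have "snd (f x') \<noteq> e'" using inB that by blast
          moreover have "fst (f x') \<notin> e'" if "snd (f x') = {}"
          proof
            assume "fst (f x') \<in> e'"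
            then have "f x' \<in> ?\<iota> ` e'" using that by (metis image_eqI prod.collapse)
            then show False using \<open>?out x'\<close> unfolding \<kappa>V by blast
          qed
          ultimately have "{f x, f x'} \<in> edges ?D" using D_cross fVG that e'ne by metis
          then show ?thesis using fedge that by blast
        qed
        \<comment> \<open>A vertex mapped to level \<open>e'\<close> is adjacent to
          \<open>x1\<close>, and one mapped outside the glued copy is adjacent to \<open>x0\<close>.
          For an isolated vertex only the ends of \<open>e'\<close> remain.\<close>
        have attach: "\<exists>c\<in>e'. f x = (c, {})" if x: "x \<in> isolated_verts H" for x
        proof -
          have xV: "x \<in> ?V" using x unfolding isolated_verts_def by simp
          have "\<not> ?inB x" using cross[OF xV x1(1) _ x1(2)] isolated_verts_edgeD[of x x1 H] x by blast
          moreover have "\<not> ?out x"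
            using cross[OF x0(1) xV] isolated_verts_edgeD[of x0 x H] x unfolding e'_def by blast
          ultimately show ?thesis unfolding \<kappa>V by auto
        qed
        have nonnbr: "x' \<in> isolated_verts H \<Longrightarrow> x \<in> ?V \<Longrightarrow> {f x', f x} \<notin> edges ?D" for x x'
          using fedge[of x' x] isolated_verts_edgeD[of x' x H] unfolding isolated_verts_def by blast
        obtain d where d: "d \<in> isolated_verts H" using iso by blast
        have dV: "d \<in> ?V" using d unfolding isolated_verts_def by simp
        obtain c where c: "c \<in> e'" "f d = (c, {})" using attach[OF d] by blast
        obtain c' where c': "e' = {c, c'}" "c \<noteq> c'" using simple_graph_edgeE[OF H e'E c(1)] .
        \<comment> \<open>The edge \<open>e'\<close> survives in \<open>?D\<close>, so its other end
          is adjacent to the image of the isolated vertex \<open>d\<close> and cannot belong to the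
          copy.\<close>
        have notc': "f x \<noteq> (c', {})" if "x \<in> ?V" for x
          using nonnbr[OF d that] e'D c(2) c'(1) by auto
        have only: "x = d" if x: "x \<in> isolated_verts H" for x
        proof -
          have xV: "x \<in> ?V" using x unfolding isolated_verts_def by simp
          have "f x = f d" using attach[OF x] notc'[OF xV] c c' by auto
          then show ?thesis using injf xV dV by (auto dest: inj_onD)
        qed
        have isod: "isolated_verts H = {d}" using only d by blast
        define r where "r = role e' c"
        have r: "r \<in> {y, z}" unfolding r_def role_def by simp
        \<comment> \<open>\<open>Y\<close> competes with \<open>X\<close> in the minimality
          assumption. All other nonisolated vertices go outside the glued copy, since one end of
          \<open>e'\<close> is taken by \<open>d\<close> and the other is excluded; hence
          \<open>Y\<close> is completely joined to them.\<close>
        define Y where "Y = {x \<in> ?V. ?inB x}"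
        have "d \<notin> Y" unfolding Y_def using c(2) e'ne by simp
        have Y: "Y \<subseteq> ?V - isolated_verts H" using \<open>d \<notin> Y\<close> isod unfolding Y_def by auto
        have "?out x" if "x \<in> ?V - isolated_verts H - Y" for x
        proof
          assume "f x \<in> \<kappa> ` ?V"
          then have "f x = (c, {}) \<or> f x = (c', {})" using that c' unfolding \<kappa>V Y_def by auto
          then have "f x = f d" using notc' that c(2) by auto
          then have "x = d" using injf that dV by (auto dest: inj_onD)
          then show False using that d by simp
        qed
        then have "{p, q} \<in> ?E" if "p \<in> Y" "q \<in> ?V - isolated_verts H - Y" for p q
          using cross[of p q] that unfolding Y_def by blast
        moreover have "Y \<noteq> {}" using x0(1) unfolding Y_def e'_def by blast
        ultimately have "card X \<le> card Y" using min Y by blast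
        \<comment> \<open>In the copy glued on \<open>e'\<close> the vertex \<open>(c, {})\<close>
          stands for \<open>r\<close>, which lies in \<open>X\<close> and is adjacent to all
          nonisolated vertices outside \<open>X\<close>. The image of \<open>Y\<close> avoids the
          neighbours of \<open>(c, {})\<close>, which confines it to \<open>X\<close> and
          \<open>d\<close> without \<open>y\<close> and \<open>z\<close>: at most
          \<open>card X + 1 - 2\<close> vertices.\<close>
        have "f ` Y \<subseteq> (insert d X - {y, z}) \<times> {e'}"
        proof
          fix p assume "p \<in> f ` Y"
          then obtain x where x: "x \<in> ?V" "p = f x" "snd p = e'" unfolding Y_def by auto
          have pV: "fst p \<in> ?V - {y, z}" using fVG[OF x(1)] x e'ne unfolding VG_def by auto
          have "{(c, {}), p} \<notin> edges ?D" using nonnbr[OF d x(1)] c(2) x(2) by simp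
          moreover have "p \<notin> ?\<iota> ` e" using x(3) e'ne by auto
          then have "{(c, {}), p} \<noteq> ?\<iota> ` e" by blast
          ultimately have "{(c, {}), p} \<notin> edges G" unfolding edge_delete_edges by simp
          moreover have "(c, {}) \<in> VG" "p \<in> VG" using fVG[OF x(1)] fVG[OF dV] x(2) c(2) by simp_all
          moreover have "(c, {}) \<noteq> p" using x(3) e'ne by auto
          ultimately have "\<not> adj (c, {}) p" using edge by blast
          then have "{r, fst p} \<notin> ?E" using x(3) e'ne c(1) unfolding adj_def r_def by simp
          then have "fst p \<in> insert d X" using joined[of r "fst p"] r yz pV isod by auto
          then show "p \<in> (insert d X - {y, z}) \<times> {e'}" using pV x(3) by (cases p) auto
        qed
        moreover have finX: "finite X" using X finV finite_subset by blast
        ultimately have "card (f ` Y) \<le> card ((insert d X - {y, z}) \<times> {e'})"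
          by (intro card_mono) auto
        also have "\<dots> = card (insert d X - {y, z})" by (simp add: card_cartesian_product)
        also have "\<dots> = card (insert d X) - card {y, z}" using yz by (intro card_Diff_subset) auto
        also have "\<dots> \<le> card X - 1" using yz(3) card_insert_le_m1[of "Suc (card X)" X d] finX
          by (simp add: card_insert_if)
        also have "\<dots> < card X" using finX yz(1) by (metis card_gt_0_iff diff_less empty_iff zero_less_one)
        finally have "card (f ` Y) < card X" .
        moreover have "card (f ` Y) = card Y" using injf unfolding Y_def
          by (intro card_image) (auto intro: inj_on_subset)
        ultimately show False using \<open>card X \<le> card Y\<close> by simp
      qed
    qed
  qed
  have "VG \<subseteq> ?V \<times> insert {} ?E" unfolding VG_def by auto
  then show ?thesis unfolding critical_extension_def using G VG base free crit by blast
qed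

text \<open>After the deletion of \<open>e\<close>, a copy of \<open>H\<close> has its dominating vertex at an end of \<open>e\<close>. The remaining
  vertices of the copy lie in the neighbourhood of that end, which has no edges between the two glued
  copies. There, fewer vertices than in \<open>V' - {p}\<close> lie in components of at least the size of the component
  \<open>C\<close> of an end \<open>r \<noteq> p\<close> of \<open>e\<close>.\<close>

lemma critical_extension_dominating_vertex:
  assumes H: "simple_graph H" and p: "p \<in> verts H - isolated_verts H"
    and dom: "\<And>q. q \<in> verts H - isolated_verts H \<Longrightarrow> q \<noteq> p \<Longrightarrow> {p, q} \<in> edges H"
    and e: "e \<in> edges H"
  shows "\<exists>G. critical_extension H e G"
proof -
  let ?E = "edges H"
  let ?V = "verts H"
  let ?V' = "?V - isolated_verts H"
  let ?\<iota> = "\<lambda>x::'a. (x, {}::'a set)"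
  have finV: "finite ?V" using H unfolding simple_graph_def by simp
  have E2: "x \<noteq> x'" "x \<in> ?V" "x' \<in> ?V" if "{x, x'} \<in> ?E" for x x'
    using simple_graph_edgeD[OF H that] .
  have EV': "x \<in> ?V'" "x' \<in> ?V'" if "{x, x'} \<in> ?E" for x x'
    using E2[OF that] isolated_verts_edgeD[OF that] by blast+
  obtain u v where uv: "e = {u, v}" "u \<noteq> v" "u \<in> ?V" "v \<in> ?V" using simple_graphE[OF H e] .
  have ene: "e \<noteq> {}" "{} \<noteq> e" using uv(1) by blast+
  have eV': "u \<in> ?V'" "v \<in> ?V'" using EV' e uv(1) by blast+
  define \<tau> where "\<tau> x = (if x = u then v else if x = v then u else x)" for x
  have \<tau>e: "\<tau> x \<in> e \<longleftrightarrow> x \<in> e" for x using uv unfolding \<tau>_def by auto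
  have \<tau>\<tau>: "\<tau> (\<tau> x) = x" for x unfolding \<tau>_def by simp
  have \<tau>id: "x \<notin> e \<Longrightarrow> \<tau> x = x" for x using uv(1) unfolding \<tau>_def by simp
  have e\<tau>: "e = {x, \<tau> x}" "x \<noteq> \<tau> x" if "x \<in> e" for x using that uv unfolding \<tau>_def by auto
  \<comment> \<open>A single new copy on level \<open>e\<close>, sharing the ends of
    \<open>e\<close> with the old one. An old vertex has neighbours on level \<open>e\<close> only
    if it is an end of \<open>e\<close>, and there it acts as the opposite end.\<close>
  define VG where "VG = ?V \<times> {{}} \<union> (?V - e) \<times> {e}"
  define adj where "adj a b \<longleftrightarrow>
    (if snd a = snd b then {fst a, fst b} \<in> ?E
     else if snd a = {} then fst a \<in> e \<and> {\<tau> (fst a), fst b} \<in> ?E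
     else if snd b = {} then fst b \<in> e \<and> {\<tau> (fst b), fst a} \<in> ?E
     else False)" for a b :: "'a \<times> 'a set"
  have "symp adj" by (rule sympI) (auto simp: adj_def insert_commute split: if_splits)
  define G where "G = graph_on VG adj"
  have VG: "verts G = VG" unfolding G_def by simp
  have edge: "{a, b} \<in> edges G \<longleftrightarrow> a \<in> VG \<and> b \<in> VG \<and> a \<noteq> b \<and> adj a b" for a b
    unfolding G_def by (rule edge_graph_on[OF \<open>symp adj\<close>])
  have "finite VG" unfolding VG_def using finV by auto
  then have G: "simple_graph G" unfolding G_def by (rule simple_graph_on)
  have base: "embeds ?\<iota> H G"
    unfolding embeds_def edge VG by (auto simp: inj_on_def VG_def adj_def dest: E2)
  define \<kappa> where "\<kappa> x = (\<tau> x, if x \<in> e then {} else e)" for x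
  have inj\<kappa>: "inj \<kappa>" unfolding \<kappa>_def by (rule injI) (metis \<tau>\<tau> prod.inject)
  have VG\<kappa>: "\<kappa> x \<in> VG" if "x \<in> ?V" for x
    using that uv(3,4) \<tau>id[of x] unfolding VG_def \<kappa>_def \<tau>_def by auto
  have adj\<kappa>: "adj (\<kappa> x) (\<kappa> x') \<longleftrightarrow> {x, x'} \<in> ?E" if "x \<noteq> x'" for x x'
  proof (cases "x \<in> e"; cases "x' \<in> e")
    assume "x \<in> e" "x' \<in> e"
    moreover from this have "{\<tau> x, \<tau> x'} = {x, x'}" using that uv unfolding \<tau>_def by auto
    ultimately show ?thesis unfolding \<kappa>_def adj_def by simp
  next
    assume "x \<in> e" "x' \<notin> e"
    then show ?thesis using ene \<tau>id unfolding \<kappa>_def adj_def by (simp add: \<tau>\<tau> \<tau>e)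
  next
    assume "x \<notin> e" "x' \<in> e"
    then show ?thesis using ene \<tau>id unfolding \<kappa>_def adj_def by (simp add: \<tau>\<tau> \<tau>e insert_commute)
  next
    assume "x \<notin> e" "x' \<notin> e"
    then show ?thesis using \<tau>id unfolding \<kappa>_def adj_def by simp
  qed
  have embeds_copy: "embeds \<kappa> H G" unfolding embeds_def edge VG
  proof (intro conjI ballI)
    show "inj_on \<kappa> ?V" using inj\<kappa> by (rule inj_on_subset) simp
    show "\<kappa> ` ?V \<subseteq> VG" using VG\<kappa> by blast
    fix x x' assume "x \<in> ?V" "x' \<in> ?V"
    then show "{x, x'} \<in> ?E \<longleftrightarrow> \<kappa> x \<in> VG \<and> \<kappa> x' \<in> VG \<and> \<kappa> x \<noteq> \<kappa> x' \<and> adj (\<kappa> x) (\<kappa> x')"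
      using VG\<kappa> adj\<kappa> inj\<kappa> E2(1) by (metis injD)
  qed
  have \<kappa>e: "\<kappa> ` e = ?\<iota> ` e"
  proof -
    have "\<kappa> u = (v, {})" "\<kappa> v = (u, {})" using uv(1,2) unfolding \<kappa>_def \<tau>_def by simp_all
    then show ?thesis unfolding uv(1) by auto
  qed
  \<comment> \<open>The two copies have only the edge \<open>e\<close> in common, so deleting
    another edge of the old copy leaves the second copy intact.\<close>
  have crit: "\<not> H_free H (delete_edges G {?\<iota> ` e'})" if e': "e' \<in> ?E - {e}" for e'
  proof
    assume "H_free H (delete_edges G {?\<iota> ` e'})"
    then obtain s where s: "s \<in> ?E" "\<kappa> ` s = ?\<iota> ` e'"
      using embeds_hits_deleted[OF H G embeds_copy] by blast
    have "s \<subseteq> e"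
    proof
      fix x assume "x \<in> s"
      then have "\<kappa> x \<in> ?\<iota> ` e'" using s(2) by blast
      then show "x \<in> e" using ene unfolding \<kappa>_def by (auto split: if_splits)
    qed
    moreover have "card s = 2" "card e = 2" using H s(1) e unfolding simple_graph_def by auto
    ultimately have "s = e" by (metis card_subset_eq card.infinite zero_neq_numeral)
    then have "?\<iota> ` e = ?\<iota> ` e'" using s(2) \<kappa>e by simp
    then have "e = e'" using inj_image_eq_iff[of ?\<iota> e e'] by (simp add: inj_def)
    then show False using e' by simp
  qed
  have free: "H_free H (delete_edges G {?\<iota> ` e})"
  proof (rule ccontr)
    let ?D = "delete_edges G {?\<iota> ` e}"
    \<comment> \<open>An embedding may place isolated vertices outside the copy that holds the rest,
      so \<open>f\<close> is compared with the two copies on the nonisolated vertices only.\<close>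
    let ?H' = "(?V', ?E)"
    have D: "simple_graph ?D" by (rule simple_graph_delete_edges[OF G])
    have H': "simple_graph ?H'" using H unfolding simple_graph_def isolated_verts_def by auto
    have restrict: "embeds g ?H' G'" if "embeds g H G'" for g and G' :: "('a \<times> 'a set) graph"
      using that unfolding embeds_def by (auto intro: inj_on_subset)
    assume "\<not> H_free H ?D"
    then obtain f where f: "embeds f H ?D" using H_free_iff_no_embedding[OF H D] by blast
    have "?\<iota> ` e \<in> (\<lambda>s. ?\<iota> ` s) ` edges ?H'" using e by simp
    from embeds_delete_edge_not_subset[OF H' G restrict[OF base] this restrict[OF f]]
    have not_base: "\<not> f ` ?V' \<subseteq> ?\<iota> ` ?V'" by simp
    have "?\<iota> ` e \<in> (\<lambda>s. \<kappa> ` s) ` edges ?H'" using e \<kappa>e by (simp add: image_iff) metis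
    from embeds_delete_edge_not_subset[OF H' G restrict[OF embeds_copy] this restrict[OF f]]
    have not_copy: "\<not> f ` ?V' \<subseteq> \<kappa> ` ?V'" by simp
    have injf: "inj_on f ?V" using f unfolding embeds_def by simp
    have fVG: "f x \<in> VG" if "x \<in> ?V" for x
      using f that VG unfolding embeds_def delete_edges_def by auto
    have fedge: "adj (f x) (f x')" "{f x, f x'} \<noteq> ?\<iota> ` e" if "{x, x'} \<in> ?E" for x x'
    proof -
      have "{f x, f x'} \<in> edges ?D" using f that E2(2,3)[OF that] unfolding embeds_def by blast
      then show "adj (f x) (f x')" "{f x, f x'} \<noteq> ?\<iota> ` e" unfolding edge_delete_edges edge by simp_all
    qed
    define w where "w = fst (f p)"
    have pV: "p \<in> ?V" using p by simp
    obtain q0 where q0: "q0 \<in> ?V'" "q0 \<noteq> p" using eV' uv(2) by blast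
    have adjp: "adj (f p) (f x)" "{f p, f x} \<noteq> ?\<iota> ` e" if "x \<in> ?V'" "x \<noteq> p" for x
      using fedge[OF dom[OF that]] .
    show False
    proof (cases "w \<in> e")
      \<comment> \<open>Away from the ends of \<open>e\<close>, a vertex has all its neighbours in
        one of the two copies. Since \<open>p\<close> dominates, the nonisolated vertices all land
        in that copy, which has been excluded.\<close>
      case False
      show False
      proof (cases "snd (f p) = {}")
        case True
        have 1: "snd (f x) = {} \<and> {w, fst (f x)} \<in> ?E" if "x \<in> ?V'" "x \<noteq> p" for x
          using adjp(1)[OF that] False True unfolding adj_def w_def by (auto split: if_splits)
        have "f x \<in> ?\<iota> ` ?V'" if "x \<in> ?V'" for x
        proof (cases "x = p")
          case False
          then show ?thesis using 1[OF that] EV'(2) by (metis image_eqI prod.collapse)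
        next
          case eq: True
          then show ?thesis using 1[OF q0] EV'(1) True unfolding w_def by (metis image_eqI prod.collapse)
        qed
        then show False using not_base by blast
      next
        case level: False
        then have snde: "snd (f p) = e" using fVG[OF pV] unfolding VG_def by auto
        have 1: "(snd (f x) = e \<and> {w, fst (f x)} \<in> ?E) \<or>
            (snd (f x) = {} \<and> fst (f x) \<in> e \<and> {\<tau> (fst (f x)), w} \<in> ?E)" if "x \<in> ?V'" "x \<noteq> p" for x
          using adjp(1)[OF that] snde ene unfolding adj_def w_def by (auto split: if_splits)
        have wV': "w \<in> ?V'" using 1[OF q0] EV' by blast
        have "f x \<in> \<kappa> ` ?V'" if x: "x \<in> ?V'" for x
        proof (cases "x = p")
          case True
          have "f p = \<kappa> w" using snde False \<tau>id unfolding \<kappa>_def w_def by (simp add: prod_eq_iff)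
          then show ?thesis using True wV' by blast
        next
          case ne: False
          from 1[OF x ne] show ?thesis
          proof
            assume *: "snd (f x) = e \<and> {w, fst (f x)} \<in> ?E"
            then have "fst (f x) \<notin> e" using fVG[of x] x ene unfolding VG_def by (cases "f x") auto
            then have "f x = \<kappa> (fst (f x))" using * \<tau>id unfolding \<kappa>_def by (simp add: prod_eq_iff)
            then show ?thesis using * EV'(2) by blast
          next
            assume *: "snd (f x) = {} \<and> fst (f x) \<in> e \<and> {\<tau> (fst (f x)), w} \<in> ?E"
            then have "f x = \<kappa> (\<tau> (fst (f x)))" unfolding \<kappa>_def by (simp add: prod_eq_iff \<tau>\<tau> \<tau>e)
            then show ?thesis using * EV'(1) by blast
          qed
        qed
        then show False using not_copy by blast
      qed
    next
      case True
      then have level: "snd (f p) = {}" using fVG[OF pV] unfolding VG_def w_def by auto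
      then have fp: "f p = (w, {})" unfolding w_def by (simp add: prod_eq_iff)
      define R where "R = ?V' - {p}"
      have finR: "finite R" unfolding R_def using finV by simp
      define h where "h x = fst (f x)" for x
      \<comment> \<open>The vertex of \<open>H\<close> that \<open>(w, {})\<close> represents in the
        copy belonging to level \<open>l\<close>: \<open>w\<close> itself in the old copy, the
        opposite end in the new one.\<close>
      define end_of where "end_of l = (if l = {} then w else \<tau> w)" for l :: "'a set"
      have end_in: "end_of l \<in> e" for l using True \<tau>e unfolding end_of_def by simp
      \<comment> \<open>On level \<open>{}\<close> the other end of \<open>e\<close> is not a
        neighbour of \<open>(w, {})\<close>, because that edge is deleted; level \<open>e\<close>
        contains no end of \<open>e\<close>. So \<open>h\<close> avoids \<open>e\<close>.\<close>
      have nbr: "{end_of (snd (f x)), h x} \<in> ?E \<and> h x \<notin> e" if x: "x \<in> R" for x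
      proof -
        have x': "x \<in> ?V'" "x \<noteq> p" "x \<in> ?V" using x unfolding R_def by auto
        have a: "adj (w, {}) (f x)" "{(w, {}), f x} \<noteq> ?\<iota> ` e" using adjp[OF x'(1,2)] fp by simp_all
        show ?thesis
        proof (cases "snd (f x) = {}")
          case l: True
          then have E: "{w, h x} \<in> ?E" using a(1) unfolding adj_def h_def by simp
          have "f x = (h x, {})" using l unfolding h_def by (simp add: prod_eq_iff)
          then have "{w, h x} \<noteq> e" using a(2) by auto
          moreover have "h x \<noteq> w" using E2(1)[OF E] by simp
          ultimately have "h x \<notin> e" using e\<tau>[OF True] by auto
          then show ?thesis using E l unfolding end_of_def by simp
        next
          case l: False
          then have "snd (f x) = e" "h x \<notin> e" using fVG[OF x'(3)] unfolding VG_def h_def by auto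
          then show ?thesis using a(1) l unfolding adj_def h_def end_of_def by simp
        qed
      qed
      \<comment> \<open>Edges between the two levels use an end of \<open>e\<close>, which
        \<open>h\<close> avoids.\<close>
      have adj_step: "snd (f x) = snd (f x') \<and> {h x, h x'} \<in> ?E" if "x \<in> R" "x' \<in> R" "{x, x'} \<in> ?E" for x x'
        using fedge(1)[OF that(3)] nbr[OF that(1)] nbr[OF that(2)] unfolding adj_def h_def
        by (auto split: if_splits)
      have injh: "inj_on h S" if "S \<subseteq> R" "\<And>x x'. x \<in> S \<Longrightarrow> x' \<in> S \<Longrightarrow> snd (f x) = snd (f x')" for S
      proof (rule inj_onI)
        fix x x' assume x: "x \<in> S" "x' \<in> S" "h x = h x'"
        then have "f x = f x'" using that(2)[OF x(1,2)] unfolding h_def by (simp add: prod_eq_iff)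
        then show "x = x'" using injf x that(1) unfolding R_def by (auto dest: inj_onD)
      qed
      \<comment> \<open>For \<open>x\<close> in \<open>R\<close>, \<open>C x\<close> is the
        component of \<open>x\<close> in the subgraph induced on \<open>R\<close>. Edges in
        \<open>R\<close> stay on a level, so each component lands on one level, where
        \<open>h\<close> is injective.\<close>
      define \<rho> where "\<rho> = {(a, b). a \<in> R \<and> b \<in> R \<and> {a, b} \<in> ?E}"
      define C where "C x = \<rho>\<^sup>* `` {x}" for x
      have Crefl: "x \<in> C x" for x unfolding C_def by simp
      have "sym \<rho>" unfolding \<rho>_def by (rule symI) (auto simp: insert_commute)
      then have symr: "sym (\<rho>\<^sup>*)" by (rule sym_rtrancl)
      have Csym: "C y = C x" if "y \<in> C x" for x y
        using that symD[OF symr] unfolding C_def by (auto intro: rtrancl_trans)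
      have CR: "C x \<subseteq> R" if x: "x \<in> R" for x
      proof
        fix y assume "y \<in> C x"
        then have "(x, y) \<in> \<rho>\<^sup>*" unfolding C_def by simp
        then show "y \<in> R" by (cases rule: rtranclE) (use x in \<open>auto simp: \<rho>_def\<close>)
      qed
      have finC: "finite (C x)" if "x \<in> R" for x using CR[OF that] finR by (rule finite_subset)
      have Cnbr: "y \<in> C x" if "a \<in> C x" "a \<in> R" "y \<in> R" "{a, y} \<in> ?E" for a x y
        using that unfolding C_def \<rho>_def by (auto intro: rtrancl_into_rtrancl)
      have Clevel: "snd (f y) = snd (f x)" if "y \<in> C x" for x y
      proof -
        have "(x, y) \<in> \<rho>\<^sup>*" using that unfolding C_def by simp
        then show ?thesis by induction (use adj_step in \<open>auto simp: \<rho>_def\<close>)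
      qed
      have injhC: "card (h ` C x) = card (C x)" if "x \<in> R" for x
        using CR[OF that] Clevel by (intro card_image injh) auto
      have nbrC: "{end_of (snd (f x)), y} \<in> ?E \<and> y \<notin> e" if x: "x \<in> R" and y: "y \<in> h ` C x" for x y
      proof -
        obtain a where a: "a \<in> C x" "y = h a" using y by blast
        then show ?thesis using nbr[of a] CR[OF x] Clevel[OF a(1)] by auto
      qed
      show False
      proof (cases "p \<in> e")
        \<comment> \<open>Both ends of \<open>e\<close> lie in the component of \<open>w\<close>.
          Its image under \<open>h\<close> consists of neighbours of an end of \<open>e\<close>, but
          avoids \<open>e\<close>: apart from \<open>p\<close> these are component vertices other
          than the two ends. One vertex gained and two lost contradicts injectivity.\<close>
        case False
        have eR: "a \<in> R" if "a \<in> e" for a using that False eV' uv(1) unfolding R_def by auto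
        have wR: "w \<in> R" using eR True by blast
        have eC: "e \<subseteq> C w"
          using Crefl Cnbr[OF Crefl wR eR[of "\<tau> w"]] e e\<tau>(1)[OF True] \<tau>e True by auto
        have "h ` C w \<subseteq> insert p (C w - e)"
        proof
          fix y assume y: "y \<in> h ` C w"
          let ?a = "end_of (snd (f w))"
          have E: "{?a, y} \<in> ?E" "y \<notin> e" using nbrC[OF wR y] by simp_all
          have "y \<in> C w" if "y \<noteq> p"
            using Cnbr[of ?a w y] end_in eC eR EV'(2)[OF E(1)] E(1) that unfolding R_def by blast
          then show "y \<in> insert p (C w - e)" using E(2) by blast
        qed
        then have "card (h ` C w) \<le> card (insert p (C w - e))"
          using finC[OF wR] by (intro card_mono) auto
        also have "\<dots> \<le> Suc (card (C w - e))" using finC[OF wR] by (simp add: card_insert_if)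
        also have "card (C w - e) = card (C w) - card e" using eC uv(1) by (intro card_Diff_subset) auto
        finally have "card (C w) \<le> Suc (card (C w) - 2)"
          using injhC[OF wR] uv(1,2) by simp
        moreover have "card e \<le> card (C w)" using finC[OF wR] eC by (rule card_mono)
        ultimately show False using uv(1,2) by simp
      next
        case pe: True
        define r where "r = \<tau> p"
        have er: "e = {p, r}" "p \<noteq> r" unfolding r_def using e\<tau>[OF pe] .
        have rR: "r \<in> R" using er eV' uv(1) unfolding R_def by auto
        have hR: "h x \<in> R" if "x \<in> R" for x
          using nbr[OF that] EV'(2) pe unfolding R_def by auto
        \<comment> \<open>Here \<open>h\<close> maps \<open>R\<close> to itself and preserves
          adjacency, so it carries components into components.\<close>
        have hC: "h ` C x \<subseteq> C (h x)" if x: "x \<in> R" for x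
        proof
          fix y assume "y \<in> h ` C x"
          then obtain a where a: "(x, a) \<in> \<rho>\<^sup>*" "y = h a" unfolding C_def by blast
          from a(1) have "(h x, h a) \<in> \<rho>\<^sup>*"
          proof induction
            case (step b c)
            then have bc: "b \<in> R" "c \<in> R" "{b, c} \<in> ?E" unfolding \<rho>_def by auto
            then have "(h b, h c) \<in> \<rho>" using adj_step hR unfolding \<rho>_def by blast
            then show ?case using step.IH by (rule rtrancl_into_rtrancl[rotated])
          qed simp
          then show "y \<in> C (h x)" using a(2) unfolding C_def by simp
        qed
        \<comment> \<open>As \<open>h\<close> never takes the value \<open>r\<close>, a component at
          least as large as that of \<open>r\<close> has no room in it.\<close>
        have not_in: "\<not> h ` C x \<subseteq> C r" if "x \<in> R" "card (C r) \<le> card (C x)" for x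
        proof
          assume "h ` C x \<subseteq> C r"
          then have "h ` C x \<subseteq> C r - {r}" using nbrC[OF that(1)] er(1) by blast
          then have "card (h ` C x) \<le> card (C r - {r})" using finC[OF rR] by (intro card_mono) auto
          also have "\<dots> < card (C r)" using finC[OF rR] Crefl by (rule card_Diff1_less)
          finally show False using injhC[OF that(1)] that(2) by simp
        qed
        \<comment> \<open>The vertices in large components. Images of such components consist of
          neighbours of \<open>p\<close>, since neighbours of \<open>r\<close> would all lie in the
          component of \<open>r\<close>. This puts \<open>T\<close> on a single level, and
          \<open>h\<close> maps it injectively into itself while missing \<open>r\<close>, which is
          in \<open>T\<close>.\<close>
        define T where "T = {x \<in> R. card (C r) \<le> card (C x)}"
        have endT: "end_of (snd (f x)) = p" if "x \<in> T" for x
        proof (rule ccontr)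
          assume "end_of (snd (f x)) \<noteq> p"
          then have a: "end_of (snd (f x)) = r" using end_in[of "snd (f x)"] er by blast
          have x: "x \<in> R" "card (C r) \<le> card (C x)" using that unfolding T_def by auto
          have "h ` C x \<subseteq> C r"
          proof
            fix y assume y: "y \<in> h ` C x"
            have "{r, y} \<in> ?E" "y \<notin> e" using nbrC[OF x(1) y] a by auto
            then show "y \<in> C r" using Cnbr[OF Crefl rR] EV'(2) pe unfolding R_def by blast
          qed
          then show False using not_in[OF x] by blast
        qed
        have Tlevel: "snd (f x) = snd (f x')" if "x \<in> T" "x' \<in> T" for x x'
        proof -
          have "snd (f x) \<in> {{}, e}" "snd (f x') \<in> {{}, e}"
            using fVG[of x] fVG[of x'] that unfolding T_def R_def VG_def by auto
          moreover have "end_of {} \<noteq> end_of e" using e\<tau>(2)[OF True] ene unfolding end_of_def by simp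
          ultimately show ?thesis using endT[OF that(1)] endT[OF that(2)] by auto
        qed
        have "T \<subseteq> R" unfolding T_def by blast
        then have "inj_on h T" using Tlevel by (rule injh)
        moreover have "h ` T \<subseteq> T - {r}"
        proof
          fix y assume "y \<in> h ` T"
          then obtain x where x: "x \<in> R" "card (C r) \<le> card (C x)" "y = h x" unfolding T_def by blast
          have "card (h ` C x) \<le> card (C y)" using hC[OF x(1)] x(3) finC[OF hR[OF x(1)]] by (auto intro: card_mono)
          then have "y \<in> T" using injhC[OF x(1)] x hR unfolding T_def by simp
          moreover have "y \<noteq> r" using nbr[OF x(1)] er x(3) by auto
          ultimately show "y \<in> T - {r}" by blast
        qed
        moreover have "finite T" using finR unfolding T_def by simp
        ultimately have "card T \<le> card (T - {r})" by (metis card_image card_mono finite_Diff)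
        moreover have "r \<in> T" using rR unfolding T_def by simp
        ultimately show False using card_Diff1_less[OF \<open>finite T\<close>, of r] by simp
      qed
    qed
  qed
  have "VG \<subseteq> ?V \<times> insert {} ?E" unfolding VG_def using e by auto
  then show ?thesis unfolding critical_extension_def using G VG base free crit by blast
qed

lemma critical_extension_exists:
  assumes H: "simple_graph H" and iso: "isolated_verts H \<noteq> {}" and e: "e \<in> edges H"
  shows "\<exists>G. critical_extension H e G"
proof -
  define V' where "V' = verts H - isolated_verts H"
  define joined where "joined Y \<longleftrightarrow> Y \<noteq> {} \<and> Y \<subseteq> V' \<and> (\<forall>p\<in>Y. \<forall>q\<in>V' - Y. {p, q} \<in> edges H)" for Y
  obtain u v where uv: "e = {u, v}" "u \<in> verts H" using simple_graphE[OF H e] .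
  then have "u \<in> V'" using e isolated_verts_edgeD[of u v H] unfolding V'_def by blast
  \<comment> \<open>The whole of \<open>V'\<close> is joined vacuously, so a smallest candidate
    exists.\<close>
  then have "joined V'" unfolding joined_def by blast
  from ex_has_least_nat[of joined, OF this, of card]
  obtain X where X: "joined X" and min: "\<And>Y. joined Y \<Longrightarrow> card X \<le> card Y" by blast
  have XV: "X \<subseteq> V'" and XE: "\<And>p q. p \<in> X \<Longrightarrow> q \<in> V' - X \<Longrightarrow> {p, q} \<in> edges H"
    using X unfolding joined_def by blast+
  show ?thesis
  proof (cases "\<exists>y\<in>X. \<exists>z\<in>X. y \<noteq> z \<and> {y, z} \<notin> edges H")
    case True
    then obtain y z where yz: "y \<in> X" "z \<in> X" "y \<noteq> z" "{y, z} \<notin> edges H" by blast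
    have min': "card X \<le> card Y" if "Y \<noteq> {}" "Y \<subseteq> V'" "\<And>p q. p \<in> Y \<Longrightarrow> q \<in> V' - Y \<Longrightarrow> {p, q} \<in> edges H"
      for Y using that by (intro min) (simp add: joined_def)
    show ?thesis
      by (rule critical_extension_nonadjacent_pair[OF H iso XV[unfolded V'_def] XE[unfolded V'_def]
          min'[unfolded V'_def] yz e])
  next
    case False
    obtain p where p: "p \<in> X" using X unfolding joined_def by blast
    \<comment> \<open>Without a nonadjacent pair, \<open>X\<close> is a clique joined to the rest,
      so each of its vertices dominates \<open>V'\<close>.\<close>
    have dom: "{p, q} \<in> edges H" if q: "q \<in> V'" "q \<noteq> p" for q
    proof (cases "q \<in> X")
      case True
      then show ?thesis using False p q(2) by metis
    next
      case False
      then show ?thesis using XE[OF p] q(1) by blast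
    qed
    have "p \<in> V'" using p XV by blast
    from critical_extension_dominating_vertex[OF H this[unfolded V'_def] dom[unfolded V'_def] e]
    show ?thesis .
  qed
qed

section \<open>Joins of graphs\<close>

definition block :: "(nat \<times> 'c \<Rightarrow> 'b) \<Rightarrow> nat \<Rightarrow> 'c set \<Rightarrow> 'b set" where
  "block g i s = (\<lambda>v. g (i, v)) ` s"

definition join_verts :: "nat \<Rightarrow> (nat \<Rightarrow> 'c graph) \<Rightarrow> (nat \<times> 'c) set" where
  "join_verts j G = (SIGMA i:{..<j}. verts (G i))"

text \<open>The map \<open>g\<close> encodes the tagged vertices, so that instances can live on the natural numbers.\<close>

definition join_graph :: "(nat \<times> 'c \<Rightarrow> 'b) \<Rightarrow> nat \<Rightarrow> (nat \<Rightarrow> 'c graph) \<Rightarrow> 'b graph" where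
  "join_graph g j G = graph_on (g ` join_verts j G)
     (\<lambda>a b. let p = inv_into (join_verts j G) g a; q = inv_into (join_verts j G) g b
       in fst p \<noteq> fst q \<or> {snd p, snd q} \<in> edges (G (fst p)))"

lemma verts_join_graph: "verts (join_graph g j G) = g ` join_verts j G"
  by (simp add: join_graph_def)

lemma edge_join_graph:
  assumes "inj_on g (join_verts j G)" "\<And>i. i < j \<Longrightarrow> simple_graph (G i)"
    and "i < j" "v \<in> verts (G i)" "i' < j" "v' \<in> verts (G i')"
  shows "{g (i, v), g (i', v')} \<in> edges (join_graph g j G) \<longleftrightarrow> i \<noteq> i' \<or> {v, v'} \<in> edges (G i)"
proof -
  have U: "(i, v) \<in> join_verts j G" "(i', v') \<in> join_verts j G" using assms(3-6) unfolding join_verts_def by auto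
  have s: "symp (\<lambda>a b. let p = inv_into (join_verts j G) g a; q = inv_into (join_verts j G) g b
       in fst p \<noteq> fst q \<or> {snd p, snd q} \<in> edges (G (fst p)))"
    by (rule sympI) (auto simp: Let_def insert_commute)
  have "g (i, v) = g (i', v') \<longleftrightarrow> i = i' \<and> v = v'" using inj_on_eq_iff[OF assms(1) U] by simp
  moreover have "{v, v'} \<notin> edges (G i)" if "v = v'"
    using simple_graph_edgeD(1)[OF assms(2)[OF assms(3)], of v v'] that by blast
  ultimately show ?thesis
    unfolding join_graph_def edge_graph_on[OF s]
    by (auto simp: U inv_into_f_f[OF assms(1)])
qed

lemma simple_join_graph:
  assumes "\<And>i. i < j \<Longrightarrow> simple_graph (G i)"
  shows "simple_graph (join_graph g j G)"
  unfolding join_graph_def join_verts_def using assms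
  by (intro simple_graph_on finite_imageI finite_SigmaI) (auto simp: simple_graph_def)

text \<open>Tags make the blocks disjoint, so a nonempty image determines its index.\<close>

lemma block_eq_iff:
  assumes "inj_on g (join_verts j G)" "i < j" "s \<subseteq> verts (G i)" "i' < j" "t \<subseteq> verts (G i')" "s \<noteq> {}"
  shows "block g i s = block g i' t \<longleftrightarrow> i = i' \<and> s = t"
proof -
  have "block g i s = g ` ({i} \<times> s)" "block g i' t = g ` ({i'} \<times> t)" unfolding block_def by auto
  moreover have "{i} \<times> s \<subseteq> join_verts j G" "{i'} \<times> t \<subseteq> join_verts j G"
    using assms(2-5) unfolding join_verts_def by auto
  ultimately have "block g i s = block g i' t \<longleftrightarrow> {i} \<times> s = {i'} \<times> t"
    using inj_on_image_eq_iff[OF assms(1)] by simp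
  also have "\<dots> \<longleftrightarrow> i = i' \<and> s = t" using assms(6) by (simp add: times_eq_iff)
  finally show ?thesis .
qed

text \<open>Each \<open>t i\<close> lies inside one block, so the deletions spare all edges between
  blocks and act on every block separately.\<close>

lemma edge_delete_join_graph:
  assumes g: "inj_on g (join_verts j G)" and G: "\<And>i. i < j \<Longrightarrow> simple_graph (G i)"
    and t: "\<And>i. i < j \<Longrightarrow> t i \<subseteq> verts (G i)"
    and v: "i < j" "v \<in> verts (G i)" "i' < j" "v' \<in> verts (G i')"
  shows "{g (i, v), g (i', v')} \<in> edges (delete_edges (join_graph g j G) ((\<lambda>i. block g i (t i)) ` {..<j})) \<longleftrightarrow>
    i \<noteq> i' \<or> {v, v'} \<in> edges (delete_edges (G i) {t i})"
proof (cases "i = i'")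
  case True
  have "{g (i, v), g (i', v')} = block g i {v, v'}" using True unfolding block_def by auto
  moreover have "block g i {v, v'} = block g l (t l) \<longleftrightarrow> i = l \<and> {v, v'} = t l" if "l < j" for l
    using that v t[OF that] True by (intro block_eq_iff[OF g]) auto
  ultimately have "{g (i, v), g (i', v')} \<in> (\<lambda>i. block g i (t i)) ` {..<j} \<longleftrightarrow> {v, v'} = t i"
    using v(1) by auto
  then show ?thesis using True edge_join_graph[OF g G v] by (simp add: edge_delete_edges)
next
  case False
  have "{g (i, v), g (i', v')} \<noteq> block g l (t l)" if l: "l < j" for l
  proof
    assume "{g (i, v), g (i', v')} = block g l (t l)"
    then obtain a b where ab: "g (i, v) = g (l, a)" "a \<in> t l" "g (i', v') = g (l, b)" "b \<in> t l"
      unfolding block_def by (metis (no_types, lifting) imageE insertCI)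
    then show False
      using inj_on_eq_iff[OF g, of "(i, v)" "(l, a)"] inj_on_eq_iff[OF g, of "(i', v')" "(l, b)"]
        v t[OF l] l False unfolding join_verts_def by auto
  qed
  then show ?thesis using False edge_join_graph[OF g G v] by (auto simp: edge_delete_edges)
qed

text \<open>Vertices of distinct blocks are adjacent, so an isolated vertex forces a copy of \<open>H\<close> into one block.\<close>

lemma H_free_delete_join_graph_iff:
  assumes H: "simple_graph H" "isolated_verts H \<noteq> {}"
    and g: "inj_on g (join_verts j G)" and G: "\<And>i. i < j \<Longrightarrow> simple_graph (G i)"
    and t: "\<And>i. i < j \<Longrightarrow> t i \<subseteq> verts (G i)"
  shows "H_free H (delete_edges (join_graph g j G) ((\<lambda>i. block g i (t i)) ` {..<j})) \<longleftrightarrow>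
    (\<forall>i<j. H_free H (delete_edges (G i) {t i}))"
proof -
  let ?D = "delete_edges (join_graph g j G) ((\<lambda>i. block g i (t i)) ` {..<j})"
  have D: "simple_graph ?D" by (intro simple_graph_delete_edges simple_join_graph G)
  have vD: "verts ?D = g ` join_verts j G" by (simp add: delete_edges_def verts_join_graph)
  have edge: "{g (i, v), g (i', v')} \<in> edges ?D \<longleftrightarrow>
      i \<noteq> i' \<or> {v, v'} \<in> edges (delete_edges (G i) {t i})"
    if "i < j" "v \<in> verts (G i)" "i' < j" "v' \<in> verts (G i')" for i v i' v'
    by (rule edge_delete_join_graph[OF g G t that])
  have "(\<exists>f. embeds f H ?D) \<longleftrightarrow> (\<exists>i<j. \<exists>f. embeds f H (delete_edges (G i) {t i}))"
  proof
    assume "\<exists>f. embeds f H ?D"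
    then obtain f where f: "embeds f H ?D" by blast
    have "\<forall>x\<in>verts H. \<exists>q\<in>join_verts j G. f x = g q" using f unfolding embeds_def vD by blast
    then obtain \<phi> where \<phi>: "\<And>x. x \<in> verts H \<Longrightarrow> \<phi> x \<in> join_verts j G"
      "\<And>x. x \<in> verts H \<Longrightarrow> f x = g (\<phi> x)" by metis
    define h where "h x = snd (\<phi> x)" for x
    have fE: "{x, x'} \<in> edges H \<longleftrightarrow> {f x, f x'} \<in> edges ?D" if "x \<in> verts H" "x' \<in> verts H" for x x'
      using f that unfolding embeds_def by blast
    obtain d where d: "d \<in> isolated_verts H" using H(2) by blast
    have dV: "d \<in> verts H" using d unfolding isolated_verts_def by simp
    define i where "i = fst (\<phi> d)"
    have fst_h: "fst (\<phi> x) < j" "h x \<in> verts (G (fst (\<phi> x)))" if "x \<in> verts H" for x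
      using \<phi>(1)[OF that] unfolding join_verts_def h_def by auto
    have fg: "f x = g (fst (\<phi> x), h x)" if "x \<in> verts H" for x using \<phi>(2)[OF that] unfolding h_def by simp
    have fsti: "fst (\<phi> x) = i" if x: "x \<in> verts H" for x
    proof (rule ccontr)
      assume "fst (\<phi> x) \<noteq> i"
      then have "{f x, f d} \<in> edges ?D"
        using edge[OF fst_h[OF x] fst_h[OF dV]] unfolding fg[OF x] fg[OF dV] i_def by simp
      then show False using fE[OF x dV] isolated_verts_edgeD[of x d H] d by blast
    qed
    have i: "i < j" using fst_h(1)[OF dV] fsti[OF dV] by simp
    have hG: "h x \<in> verts (G i)" "f x = g (i, h x)" if "x \<in> verts H" for x
      using fst_h(2)[OF that] fg[OF that] fsti[OF that] by simp_all
    have "embeds h H (delete_edges (G i) {t i})" unfolding embeds_def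
    proof (intro conjI ballI)
      show "inj_on h (verts H)" using f hG(2) unfolding embeds_def inj_on_def by metis
      show "h ` verts H \<subseteq> verts (delete_edges (G i) {t i})" using hG(1) by (auto simp: delete_edges_def)
      fix x x' assume x: "x \<in> verts H" "x' \<in> verts H"
      show "{x, x'} \<in> edges H \<longleftrightarrow> {h x, h x'} \<in> edges (delete_edges (G i) {t i})"
        using edge[OF i hG(1)[OF x(1)] i hG(1)[OF x(2)]] fE[OF x] hG(2)[OF x(1)] hG(2)[OF x(2)] by simp
    qed
    then show "\<exists>i<j. \<exists>f. embeds f H (delete_edges (G i) {t i})" using i by blast
  next
    assume "\<exists>i<j. \<exists>f. embeds f H (delete_edges (G i) {t i})"
    then obtain i f where i: "i < j" and f: "embeds f H (delete_edges (G i) {t i})" by blast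
    have fG: "f x \<in> verts (G i)" if "x \<in> verts H" for x using f that unfolding embeds_def delete_edges_def by auto
    have U: "(i, f x) \<in> join_verts j G" if "x \<in> verts H" for x using fG[OF that] i unfolding join_verts_def by simp
    have "embeds (\<lambda>x. g (i, f x)) H ?D" unfolding embeds_def
    proof (intro conjI ballI)
      show "inj_on (\<lambda>x. g (i, f x)) (verts H)"
        using f inj_on_eq_iff[OF g U U] unfolding embeds_def inj_on_def by auto
      show "(\<lambda>x. g (i, f x)) ` verts H \<subseteq> verts ?D" unfolding vD using U by blast
      fix x x' assume x: "x \<in> verts H" "x' \<in> verts H"
      show "{x, x'} \<in> edges H \<longleftrightarrow> {g (i, f x), g (i, f x')} \<in> edges ?D"
        using edge[OF i fG[OF x(1)] i fG[OF x(2)]] f x unfolding embeds_def by simp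
    qed
    then show "\<exists>f. embeds f H ?D" by blast
  qed
  then show ?thesis
    using H_free_iff_no_embedding[OF H(1) D] H_free_iff_no_embedding[OF H(1) simple_graph_delete_edges[OF G]]
    by blast
qed

section \<open>Advice complexity of a common prefix\<close>

lemma answers_mono: "answers A \<phi> P m S m' \<Longrightarrow> m \<le> m'"
  by (induction rule: answers.induct) auto

lemma answers_cong:
  "answers A \<phi> P m S m' \<Longrightarrow> (\<And>i. i < m' \<Longrightarrow> \<phi> i = \<psi> i) \<Longrightarrow> answers A \<psi> P m S m'"
proof (induction rule: answers.induct)
  case (answers_output m S)
  have "map \<phi> [0..<m] = map \<psi> [0..<m]" using answers_output(2) by simp
  then show ?case using answers_output(1) by (metis answers.answers_output)
next
  case (answers_read m S m')
  have "map \<phi> [0..<m] = map \<psi> [0..<m]"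
    using answers_read(4) answers_mono[OF answers_read(2)] by simp
  then show ?case using answers_read(1) answers_read.IH[OF answers_read.prems]
    by (metis answers.answers_read)
qed

lemma is_run_mono:
  assumes "is_run A \<phi> I S b" "i \<le> i'" "i' \<le> num_steps I"
  shows "b i \<le> b i'"
  using assms(2,3)
proof (induction i' rule: dec_induct)
  case (step n)
  then have "answers A \<phi> (revealed I (Suc n)) (b n) (S (Suc n)) (b (Suc n))"
    using assms(1) unfolding is_run_def by auto
  then have "b n \<le> b (Suc n)" by (rule answers_mono)
  then show ?case using step by simp
qed simp

text \<open>Agreement on the first \<open>b t\<close> bits suffices: the number of bits read never
  decreases, and a step depends only on the bits read by its end.\<close>

lemma is_run_common_prefix:
  assumes "is_run A \<phi> I S b" "is_run A \<psi> I' S' b'"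
    and "\<And>i. i \<le> t \<Longrightarrow> revealed I i = revealed I' i" "t \<le> num_steps I" "t \<le> num_steps I'"
    and "\<And>i. i < b t \<Longrightarrow> \<phi> i = \<psi> i"
    and "i \<le> t"
  shows "S' i = S i \<and> b' i = b i"
  using assms(7)
proof (induction i)
  case 0
  then show ?case using assms(1,2) unfolding is_run_def by simp
next
  case (Suc i)
  have 1: "answers A \<phi> (revealed I (Suc i)) (b i) (S (Suc i)) (b (Suc i))"
    using assms(1,4) Suc.prems unfolding is_run_def by auto
  have "b (Suc i) \<le> b t" using is_run_mono[OF assms(1) Suc.prems assms(4)] .
  then have "answers A \<psi> (revealed I (Suc i)) (b i) (S (Suc i)) (b (Suc i))"
    using answers_cong[OF 1] assms(6) by auto
  moreover have "answers A \<psi> (revealed I (Suc i)) (b i) (S' (Suc i)) (b' (Suc i))"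
  proof -
    have "i < num_steps I'" using Suc.prems assms(5) by simp
    then have "answers A \<psi> (revealed I' (Suc i)) (b' i) (S' (Suc i)) (b' (Suc i))"
      using assms(2) unfolding is_run_def by blast
    then show ?thesis using assms(3)[OF Suc.prems] Suc by simp
  qed
  ultimately show ?case using answers_unique by metis
qed

text \<open>Pigeonhole: tapes with the same initial segment give the same output at step
  \<open>t\<close>, whereas the forced outputs \<open>T x\<close> are pairwise different. Hence the
  initial segments differ, and there are only \<open>2 ^ c\<close> of length
  \<open>c\<close>.\<close>

lemma advice_common_prefix:
  fixes I :: "'x \<Rightarrow> inst"
  assumes "finite X" "X \<noteq> {}" "inj_on T X"
    and steps: "\<And>x. x \<in> X \<Longrightarrow> t \<le> num_steps (I x)"
    and prefix: "\<And>x y i. x \<in> X \<Longrightarrow> y \<in> X \<Longrightarrow> i \<le> t \<Longrightarrow> revealed (I x) i = revealed (I y) i"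
    and forced: "\<And>x S. x \<in> X \<Longrightarrow> is_solution H (I x) S \<Longrightarrow>
      card (S (num_steps (I x))) = opt H (fst (I x)) \<Longrightarrow> S t = T x"
    and opt: "\<And>x. x \<in> X \<Longrightarrow> optimal_on H A (\<Phi> x) (I x)"
  shows "\<exists>x\<in>X. \<exists>c. reads_bits A (\<Phi> x) (I x) c \<and> card X \<le> 2 ^ c"
proof -
  have "\<forall>x\<in>X. \<exists>S b. is_run A (\<Phi> x) (I x) S b \<and> S t = T x"
  proof
    fix x assume x: "x \<in> X"
    obtain S b where S: "is_run A (\<Phi> x) (I x) S b" "is_solution H (I x) S"
      "card (S (num_steps (I x))) = opt H (fst (I x))"
      using opt[OF x] unfolding optimal_on_def by (elim exE conjE)
    from forced[OF x S(2,3)] S(1)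
    show "\<exists>S b. is_run A (\<Phi> x) (I x) S b \<and> S t = T x" by (intro exI conjI)
  qed
  then obtain S b where run: "\<And>x. x \<in> X \<Longrightarrow> is_run A (\<Phi> x) (I x) (S x) (b x)"
    and ST: "\<And>x. x \<in> X \<Longrightarrow> S x t = T x" by metis
  define c where "c x = b x (num_steps (I x))" for x
  \<comment> \<open>The largest number of bits read on any of the instances. All tapes are cut at
    this common length, and an instance attaining it is the witness.\<close>
  define L where "L = Max (c ` X)"
  have cL: "c x \<le> L" if "x \<in> X" for x unfolding L_def using assms(1) that by simp
  have "L \<in> c ` X" unfolding L_def using assms(1,2) by (intro Max_in) auto
  then obtain z where z: "z \<in> X" "c z = L" by auto
  have "inj_on (\<lambda>x. map (\<Phi> x) [0..<L]) X"
  proof (rule inj_onI)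
    fix x y assume xy: "x \<in> X" "y \<in> X" and eq: "map (\<Phi> x) [0..<L] = map (\<Phi> y) [0..<L]"
    have "b x t \<le> L"
      using is_run_mono[OF run[OF xy(1)] steps[OF xy(1)] order.refl] cL[OF xy(1)] unfolding c_def by simp
    then have "\<And>i. i < b x t \<Longrightarrow> \<Phi> x i = \<Phi> y i" using eq by simp
    then have "S y t = S x t"
      using is_run_common_prefix[OF run[OF xy(1)] run[OF xy(2)] prefix[OF xy] steps[OF xy(1)] steps[OF xy(2)]]
      by simp
    then have "T x = T y" using ST xy by simp
    then show "x = y" using assms(3) xy by (auto dest: inj_onD)
  qed
  then have "card X = card ((\<lambda>x. map (\<Phi> x) [0..<L]) ` X)" by (simp add: card_image)
  also have "\<dots> \<le> card {xs :: bool list. set xs \<subseteq> UNIV \<and> length xs = L}"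
    by (intro card_mono finite_lists_length_eq) auto
  also have "\<dots> = 2 ^ L" by (subst card_lists_length_eq) auto
  finally have "card X \<le> 2 ^ L" .
  moreover have "reads_bits A (\<Phi> z) (I z) L"
    using z run[OF z(1)] unfolding reads_bits_def c_def by blast
  ultimately show ?thesis using z(1) by blast
qed

lemma is_solution_mono:
  assumes "is_solution H I S" "1 \<le> i" "i \<le> i'" "i' \<le> num_steps I"
  shows "S i \<subseteq> S i'"
  using assms(3,4)
proof (induction i' rule: dec_induct)
  case (step n)
  then have "S n \<subseteq> S (Suc n)" using assms(1,2) unfolding is_solution_def by auto
  then show ?case using step by simp
qed simp

section \<open>The family of instances and the counting of edge choices\<close>

theorem theorem5:
  fixes H :: "'a graph" and k :: nat
  assumes "simple_graph H"
    and "card (isolated_verts H) = k" and "k > 0"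
    and "edges H \<noteq> {}"
  shows "needs_advice H (\<lambda>j. real j * log 2 (real (card (edges H))))"
  unfolding needs_advice_def
proof (intro allI impI)
  fix A \<Phi> and j :: nat
  assume A: "optimal H A \<and> (\<forall>I. is_instance I \<longrightarrow> optimal_on H A (\<Phi> I) I)" and j: "1 \<le> j"
  let ?V = "verts H"
  let ?E = "edges H"
  let ?\<iota> = "\<lambda>x::'a. (x, {}::'a set)"
  note H = assms(1)
  have iso: "isolated_verts H \<noteq> {}" using assms(2,3) by auto
  have finV: "finite ?V" and finE: "finite ?E"
    using H simple_graph_finite_edges[OF H] unfolding simple_graph_def by simp_all
  have "\<forall>e\<in>?E. \<exists>G. critical_extension H e G" using critical_extension_exists[OF H iso] by blast
  then obtain \<G> where \<G>: "\<And>e. e \<in> ?E \<Longrightarrow> critical_extension H e (\<G> e)" by metis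
  \<comment> \<open>One encoding serves all choices of critical edges, so the common prefix consists
    of literally the same natural numbers in every instance.\<close>
  have "finite ({..<j} \<times> ?V \<times> insert {} ?E)" using finV finE by simp
  from finite_imp_inj_to_nat_seg[OF this]
  obtain g :: "nat \<times> 'a \<times> 'a set \<Rightarrow> nat" where g: "inj_on g ({..<j} \<times> ?V \<times> insert {} ?E)" by blast
  \<comment> \<open>The choices of one critical edge per block; extensional functions make their
    number exactly \<open>card ?E ^ j\<close>.\<close>
  define X where "X = {..<j} \<rightarrow>\<^sub>E ?E"
  have Xi: "x i \<in> ?E" if "x \<in> X" "i < j" for x i using that unfolding X_def by auto
  define J where "J x = join_graph g j (\<lambda>i. \<G> (x i))" for x
  have simpleG: "simple_graph (\<G> (x i))" if "x \<in> X" "i < j" for x i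
    using \<G>[OF Xi[OF that]] unfolding critical_extension_def by simp
  have base: "embeds ?\<iota> H (\<G> (x i))" if "x \<in> X" "i < j" for x i
    using \<G>[OF Xi[OF that]] unfolding critical_extension_def by simp
  have \<iota>G: "(v, {}) \<in> verts (\<G> (x i))" if "x \<in> X" "i < j" "v \<in> ?V" for x i v
    using base[OF that(1,2)] that(3) unfolding embeds_def by auto
  have E_sub: "?\<iota> ` s \<subseteq> verts (\<G> (x i))" if "x \<in> X" "i < j" "s \<in> ?E" for x i s
    using \<iota>G[OF that(1,2)] H that(3) unfolding simple_graph_def by blast
  have gJ: "inj_on g (join_verts j (\<lambda>i. \<G> (x i)))" if "x \<in> X" for x
  proof (rule inj_on_subset[OF g])
    show "join_verts j (\<lambda>i. \<G> (x i)) \<subseteq> {..<j} \<times> ?V \<times> insert {} ?E"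
      using \<G>[OF Xi[OF that]] unfolding critical_extension_def join_verts_def by fastforce
  qed
  have simpleJ: "simple_graph (J x)" if "x \<in> X" for x
    unfolding J_def using simpleG[OF that] by (intro simple_join_graph) auto
  define \<beta> where "\<beta> i v = g (i, v, {})" for i v
  have \<beta>block: "\<beta> i ` s = block g i (?\<iota> ` s)" for i s unfolding \<beta>_def block_def by (auto simp: image_image)
  define P where "P = (\<Union>i<j. \<beta> i ` ?V)"
  have finP: "finite P" unfolding P_def using finV by simp
  have PJ: "P \<subseteq> verts (J x)" if "x \<in> X" for x
    using \<iota>G[OF that] unfolding P_def \<beta>_def J_def verts_join_graph join_verts_def by auto
  have edge\<beta>: "{\<beta> i v, \<beta> i' v'} \<in> edges (J x) \<longleftrightarrow> i \<noteq> i' \<or> {v, v'} \<in> ?E"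
    if x: "x \<in> X" and v: "i < j" "v \<in> ?V" "i' < j" "v' \<in> ?V" for x i v i' v'
  proof -
    have "{?\<iota> v, ?\<iota> v'} \<in> edges (\<G> (x i)) \<longleftrightarrow> {v, v'} \<in> ?E"
      using base[OF x v(1)] v(2,4) unfolding embeds_def by blast
    then show ?thesis
      using edge_join_graph[OF gJ[OF x] simpleG[OF x] v(1) \<iota>G[OF x v(1,2)] v(3) \<iota>G[OF x v(3,4)]]
      unfolding J_def \<beta>_def by simp
  qed
  have \<beta>inj: "\<beta> i v = \<beta> i' v' \<longleftrightarrow> i = i' \<and> v = v'" if "i < j" "v \<in> ?V" "i' < j" "v' \<in> ?V" for i v i' v'
    unfolding \<beta>_def using inj_on_eq_iff[OF g, of "(i, v, {})" "(i', v', {})"] that by simp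
  have \<beta>sets: "i = i' \<and> s = s'" if "i < j" "s \<in> ?E" "i' < j" "s' \<in> ?E" "\<beta> i ` s = \<beta> i' ` s'" for i s i' s'
  proof -
    have s: "s \<subseteq> ?V" "s' \<subseteq> ?V" "s \<noteq> {}" using H that(2,4) unfolding simple_graph_def by auto
    then obtain v where v: "v \<in> s" by blast
    then have "\<beta> i v \<in> \<beta> i' ` s'" using that(5) by blast
    then have "i = i'" using \<beta>inj that(1,3) s v by blast
    moreover have "inj_on (\<beta> i) ?V" using \<beta>inj that(1) by (auto intro: inj_onI)
    ultimately show ?thesis using inj_on_image_eq_iff[of "\<beta> i" ?V s s'] s that(5) by simp
  qed
  have card_blocks: "card ((\<lambda>i. \<beta> i ` \<epsilon> i) ` {..<j}) = j" if \<epsilon>: "\<And>i. i < j \<Longrightarrow> \<epsilon> i \<in> ?E" for \<epsilon>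
  proof -
    have "inj_on (\<lambda>i. \<beta> i ` \<epsilon> i) {..<j}"
    proof (rule inj_onI)
      fix i i' assume "i \<in> {..<j}" "i' \<in> {..<j}" and eq: "\<beta> i ` \<epsilon> i = \<beta> i' ` \<epsilon> i'"
      then have i: "i < j" "i' < j" by simp_all
      show "i = i'" using \<beta>sets[OF i(1) \<epsilon>[OF i(1)] i(2) \<epsilon>[OF i(2)] eq] by simp
    qed
    then show ?thesis by (simp add: card_image)
  qed
  have embedsP: "embeds (\<beta> i) H (induced (J x) W)" if x: "x \<in> X" and i: "i < j" and W: "P \<subseteq> W" for x i W
    unfolding embeds_def
  proof (intro conjI ballI)
    show "inj_on (\<beta> i) ?V" using \<beta>inj i by (auto intro: inj_onI)
    have im: "\<beta> i ` ?V \<subseteq> W" using i W unfolding P_def by blast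
    then show "\<beta> i ` ?V \<subseteq> verts (induced (J x) W)" unfolding induced_def by simp
    fix v v' assume v: "v \<in> ?V" "v' \<in> ?V"
    then have "{\<beta> i v, \<beta> i v'} \<subseteq> W" using im by blast
    then show "{v, v'} \<in> ?E \<longleftrightarrow> {\<beta> i v, \<beta> i v'} \<in> edges (induced (J x) W)"
      using edge\<beta>[OF x i v(1) i v(2)] unfolding induced_def by simp
  qed
  have simpleI: "simple_graph (induced (J x) W)" if "x \<in> X" "W \<subseteq> verts (J x)" for x W
    using simpleJ[OF that(1)] that(2) unfolding simple_graph_def induced_def by (auto intro: finite_subset)
  \<comment> \<open>Every block has a copy of \<open>H\<close> inside \<open>P\<close>, which must
    lose an edge, and edges of different blocks differ. This is applied to the prefix with
    \<open>W = P\<close> and to the whole graph.\<close>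
  have hit: "\<exists>\<epsilon>. (\<forall>i<j. \<epsilon> i \<in> ?E) \<and> (\<lambda>i. \<beta> i ` \<epsilon> i) ` {..<j} \<subseteq> S \<and> card ((\<lambda>i. \<beta> i ` \<epsilon> i) ` {..<j}) = j"
    if x: "x \<in> X" and W: "P \<subseteq> W" "W \<subseteq> verts (J x)" and free: "H_free H (delete_edges (induced (J x) W) S)" for x W S
  proof -
    have "\<forall>i\<in>{..<j}. \<exists>s. s \<in> ?E \<and> \<beta> i ` s \<in> S"
      using embeds_hits_deleted[OF H simpleI[OF x W(2)] embedsP[OF x _ W(1)] free] by blast
    then obtain \<epsilon> where \<epsilon>: "\<And>i. i < j \<Longrightarrow> \<epsilon> i \<in> ?E" "\<And>i. i < j \<Longrightarrow> \<beta> i ` \<epsilon> i \<in> S" by (metis lessThan_iff)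
    have "card ((\<lambda>i. \<beta> i ` \<epsilon> i) ` {..<j}) = j" by (rule card_blocks[OF \<epsilon>(1)])
    then show ?thesis using \<epsilon> by blast
  qed
  have induced_all: "induced (J x) (verts (J x)) = J x" if "x \<in> X" for x
    using simpleJ[OF that] unfolding simple_graph_def induced_def by (auto simp: prod_eq_iff)
  define T where "T x = (\<lambda>i. \<beta> i ` x i) ` {..<j}" for x
  \<comment> \<open>Deleting any edge other than the critical one from the given copy in a block
    leaves a copy of \<open>H\<close> in that block.\<close>
  have free_iff: "H_free H (delete_edges (J x) (T \<epsilon>)) \<longleftrightarrow> (\<forall>i<j. \<epsilon> i = x i)"
    if x: "x \<in> X" and \<epsilon>: "\<And>i. i < j \<Longrightarrow> \<epsilon> i \<in> ?E" for x \<epsilon>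
  proof -
    have "H_free H (delete_edges (J x) (T \<epsilon>)) \<longleftrightarrow> (\<forall>i<j. H_free H (delete_edges (\<G> (x i)) {?\<iota> ` \<epsilon> i}))"
      unfolding J_def T_def \<beta>block
      using E_sub[OF x _ \<epsilon>] by (intro H_free_delete_join_graph_iff[OF H iso gJ[OF x] simpleG[OF x]]) auto
    also have "\<dots> \<longleftrightarrow> (\<forall>i<j. \<epsilon> i = x i)"
    proof -
      have "H_free H (delete_edges (\<G> (x i)) {?\<iota> ` \<epsilon> i}) \<longleftrightarrow> \<epsilon> i = x i" if "i < j" for i
        using \<G>[OF Xi[OF x that]] \<epsilon>[OF that] unfolding critical_extension_def by auto
      then show ?thesis by blast
    qed
    finally show ?thesis .
  qed
  have card_T: "card (T x) = j" if "x \<in> X" for x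
    unfolding T_def by (rule card_blocks[OF Xi[OF that]])
  have T_sub: "T x \<subseteq> edges (J x)" if x: "x \<in> X" for x
  proof
    fix s assume "s \<in> T x"
    then obtain i where i: "i < j" "s = \<beta> i ` x i" unfolding T_def by blast
    obtain u v where uv: "x i = {u, v}" "u \<in> ?V" "v \<in> ?V" using simple_graphE[OF H Xi[OF x i(1)]] .
    then show "s \<in> edges (J x)" using edge\<beta>[OF x i(1) uv(2) i(1) uv(3)] Xi[OF x i(1)] i(2) by simp
  qed
  have opt: "opt H (J x) = j" if x: "x \<in> X" for x
    unfolding opt_def
  proof (rule Least_equality)
    show "\<exists>S\<subseteq>edges (J x). H_free H (delete_edges (J x) S) \<and> card S = j"
    proof (intro exI conjI)
      show "H_free H (delete_edges (J x) (T x))" using free_iff[of x x, OF x Xi[OF x]] by simp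
    qed (rule T_sub[OF x] card_T[OF x])+
    fix m assume "\<exists>S\<subseteq>edges (J x). H_free H (delete_edges (J x) S) \<and> card S = m"
    then obtain S where S: "S \<subseteq> edges (J x)" "H_free H (delete_edges (J x) S)" "card S = m" by blast
    have "finite S" using S(1) simple_graph_finite_edges[OF simpleJ[OF x]] by (rule finite_subset)
    moreover have "H_free H (delete_edges (induced (J x) (verts (J x))) S)"
      unfolding induced_all[OF x] by (rule S(2))
    from hit[OF x PJ[OF x] order.refl this] obtain \<epsilon>
      where "T \<epsilon> \<subseteq> S" "card (T \<epsilon>) = j" unfolding T_def by (elim exE conjE)
    ultimately show "j \<le> m" using S(3) card_mono by metis
  qed
  \<comment> \<open>The vertices of \<open>P\<close> come first, in an order independent of
    \<open>x\<close>.\<close>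
  define vs where "vs = sorted_list_of_set P"
  have vs: "set vs = P" "distinct vs" unfolding vs_def using finP by simp_all
  define I where "I x = (J x, vs @ sorted_list_of_set (verts (J x) - P))" for x
  have finJ: "finite (verts (J x))" if "x \<in> X" for x using simpleJ[OF that] unfolding simple_graph_def by simp
  have inst: "is_instance (I x)" if x: "x \<in> X" for x
    unfolding is_instance_def I_def using simpleJ[OF x] finJ[OF x] vs PJ[OF x] by auto
  have steps: "length vs \<le> num_steps (I x)" for x unfolding num_steps_def I_def by simp
  have rev: "revealed (I x) i = (induced (J x) (set (take i vs)), take i vs)" if "i \<le> length vs" for x i
    using that unfolding revealed_def I_def by simp
  have rev_all: "fst (revealed (I x) (num_steps (I x))) = J x" if x: "x \<in> X" for x
  proof -
    have "set (snd (I x)) = verts (J x)" using inst[OF x] unfolding is_instance_def I_def by simp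
    then show ?thesis using induced_all[OF x] unfolding revealed_def num_steps_def I_def by simp
  qed
  have edges_P: "s \<in> edges (J y)" if x: "x \<in> X" and y: "y \<in> X" and s: "s \<in> edges (J x)" "s \<subseteq> P" for x y s
  proof -
    obtain a b where ab: "s = {a, b}" using simple_graphE[OF simpleJ[OF x] s(1)] .
    with s(2) have "a \<in> P" "b \<in> P" by simp_all
    then obtain i v i' v' where "a = \<beta> i v" "b = \<beta> i' v'" and v: "i < j" "v \<in> ?V" "i' < j" "v' \<in> ?V"
      unfolding P_def by auto
    then show ?thesis using edge\<beta>[OF x v] edge\<beta>[OF y v] s(1) ab by simp
  qed
  have prefix: "revealed (I x) i = revealed (I y) i" if "x \<in> X" "y \<in> X" "i \<le> length vs" for x y i
  proof -
    have "set (take i vs) \<subseteq> P" using vs(1) set_take_subset by fastforce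
    then have "induced (J x) (set (take i vs)) = induced (J y) (set (take i vs))"
      using edges_P[OF that(1,2)] edges_P[OF that(2,1)] unfolding induced_def by blast
    then show ?thesis using rev[OF that(3)] by simp
  qed
  have "?V \<noteq> {}" using iso unfolding isolated_verts_def by blast
  then obtain v where "v \<in> ?V" by blast
  then have "\<beta> 0 v \<in> P" using j unfolding P_def by (intro UN_I[of 0]) auto
  then have "P \<noteq> {}" by blast
  \<comment> \<open>Solutions are constrained from step 1 on, so the prefix must be
    nonempty.\<close>
  then have len: "1 \<le> length vs" using vs(1) by (cases vs) auto
  have forced: "S (length vs) = T x"
    if x: "x \<in> X" and sol: "is_solution H (I x) S" and card: "card (S (num_steps (I x))) = opt H (fst (I x))" for x S
  proof -
    let ?n = "num_steps (I x)"
    have sound: "S i \<subseteq> edges (fst (revealed (I x) i)) \<and> H_free H (delete_edges (fst (revealed (I x) i)) (S i))"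
      if "1 \<le> i" "i \<le> ?n" for i using sol that unfolding is_solution_def by auto
    have "fst (revealed (I x) (length vs)) = induced (J x) P" using rev[of "length vs" x] vs(1) by simp
    then have St: "H_free H (delete_edges (induced (J x) P) (S (length vs)))"
      using sound[OF len steps] by simp
    have Sn: "S ?n \<subseteq> edges (J x)" "H_free H (delete_edges (J x) (S ?n))"
      using sound[of ?n] len steps[of x] unfolding rev_all[OF x] by auto
    have fin: "finite (S ?n)" using Sn(1) simple_graph_finite_edges[OF simpleJ[OF x]] by (rule finite_subset)
    have cardn: "card (S ?n) = j" using card opt[OF x] unfolding I_def by simp
    have mono: "S (length vs) \<subseteq> S ?n" by (rule is_solution_mono[OF sol len steps order.refl])
    obtain \<epsilon> where \<epsilon>: "\<And>i. i < j \<Longrightarrow> \<epsilon> i \<in> ?E" "T \<epsilon> \<subseteq> S (length vs)" "card (T \<epsilon>) = j"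
      using hit[OF x order.refl PJ[OF x] St] unfolding T_def by (elim exE conjE) blast
    \<comment> \<open>The prefix alone costs \<open>j\<close> deletions, the whole budget, so the
      final set is already fixed there.\<close>
    have "T \<epsilon> = S ?n" using \<epsilon>(2,3) mono fin cardn by (intro card_subset_eq) auto
    then have "\<forall>i<j. \<epsilon> i = x i" using free_iff[of x \<epsilon>, OF x \<epsilon>(1)] Sn(2) by simp
    then have "T \<epsilon> = T x" unfolding T_def by (intro image_cong) auto
    then show ?thesis using \<open>T \<epsilon> = S ?n\<close> \<epsilon>(2) mono by blast
  qed
  have "inj_on T X"
  proof (rule inj_onI)
    fix x y assume xy: "x \<in> X" "y \<in> X" "T x = T y"
    have "x i = y i" if i: "i < j" for i
    proof -
      have "\<beta> i ` x i \<in> T x" using i unfolding T_def by blast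
      then have "\<beta> i ` x i \<in> T y" using xy(3) by simp
      then obtain i' where "i' < j" "\<beta> i ` x i = \<beta> i' ` y i'" unfolding T_def by blast
      then show ?thesis using \<beta>sets[OF i Xi[OF xy(1) i] _ Xi[OF xy(2)]] by blast
    qed
    then show "x = y" using xy(1,2) unfolding X_def by (intro PiE_ext) auto
  qed
  moreover have "finite X" unfolding X_def using finE by (intro finite_PiE) auto
  moreover have "X \<noteq> {}" unfolding X_def using assms(4) by (simp add: PiE_eq_empty_iff)
  ultimately obtain x c where x: "x \<in> X" and c: "reads_bits A (\<Phi> (I x)) (I x) c" "card X \<le> 2 ^ c"
    using advice_common_prefix[of X T "length vs" I H A "\<lambda>x. \<Phi> (I x)"] steps prefix forced A inst by blast
  have m: "card ?E > 0" using assms(4) finE by (simp add: card_gt_0_iff)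
  have "card X = card ?E ^ j" unfolding X_def by (simp add: card_PiE)
  then have "card ?E ^ j \<le> 2 ^ c" using c(2) by simp
  then have "real (card ?E) ^ j \<le> 2 ^ c" by (metis of_nat_le_iff of_nat_numeral of_nat_power)
  then have "log 2 (real (card ?E) ^ j) \<le> log 2 (2 ^ c)" using m by (subst log_le_cancel_iff) auto
  then have "real j * log 2 (real (card ?E)) \<le> real c" using m by (simp add: log_nat_power)
  moreover have optI: "opt H (fst (I x)) = j" using opt[OF x] unfolding I_def by simp
  ultimately show "\<exists>I c. is_instance I \<and> opt H (fst I) = j \<and> reads_bits A (\<Phi> I) I c \<and>
      real j * log 2 (real (card ?E)) \<le> real c"
    using inst[OF x] optI c(1) by blast
qed

end
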